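(* Let $\mathcal B\in\Pi^d$. 1. Let $\{u_n\}_{n=1}^\infty\subset L^1(Q)$ and $u\in L^1(Q)$ satisfy one of the following conditions: (i) $\{u_n\}$ is locally uniformly integrable and $u_n\to u$ a.e. in $Q$; (ii) $u_n\stackrel{*}{\rightharpoonup}u$ weakly* in $\mathcal M_b(Q)$. Then $$\liminf_{n\to\infty}PV_{\mathcal B}(u_n)\ge PV_{\mathcal B}(u).$$ 2. Let $u\in BV_{\mathcal B}(Q)$. Then there exist a Radon measure $\mu$ on $Q$ and a $\mu$-measurable function $\sigma:Q\to\mathbb R^K$ such that $|\sigma(x)|=1$ for $\mu$-a.e. $x$, and for all $\varphi\in C_c^\infty(Q;\mathbb R^K)$ $$\int_Qu\,\mathcal B^*\varphi\,dx=-\int_Q\varphi\cdot\sigma\,d\mu.$$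
   Context: Let $d,N\ge1$ be integers and $Q=(0,1)^N$. For $1\le h\le d$, $H^hu\in\mathcal D'(Q;\mathbb R^{N^h})$ is the array of all $h$-th order distributional partial derivatives of $u$. Put $K=\sum_{h=1}^dN^h$, so $\mathbb R^K=\bigoplus_{h=1}^d\mathbb R^{N^h}$. $\Pi^d$ is the set of operators $\mathcal B$ given by real matrices $B^h\in\mathbb R^{N^h\times N^h}$, $1\le h\le d$, through $\mathcal Bu=(B^1H^1u,\dots,B^dH^du)\in\mathcal D'(Q;\mathbb R^K)$. $\mathcal B^*$ is the formal adjoint: $\int_Qu\,\mathcal B^*\varphi\,dx=\int_Q\varphi\cdot\mathcal Bu\,dx$ for $\varphi\in C_c^\infty(Q;\mathbb R^K)$ and smooth $u$. For $u\in L^1(Q)$, $PV_{\mathcal B}(u)=\sup\{\int_Qu\,\mathcal B^*\varphi\,dx:\varphi\in C_c^\infty(Q;\mathbb R^K),\ |\varphi|\le1\}\in[0,+\infty]$ (Euclidean norm on $\mathbb R^K$), and $BV_{\mathcal B}(Q)=\{u\in L^1(Q):PV_{\mathcal B}(u)<+\infty\}$. $\mathcal M_b(Q)$ is the space of finite signed Radon measures on $Q$, and $u_n,u$ are identified with the measures $u_n\,dx,u\,dx$. Locally uniformly integrable means uniformly integrable on every compact subset of $Q$. *)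

theory Defs
  imports "HOL-Analysis.Analysis"
begin

definition cube :: "(real ^ 'n) set" where
  "cube = {x. \<forall>i. 0 < x $ i \<and> x $ i < 1}"

definition partial :: "'n \<Rightarrow> (real ^ 'n \<Rightarrow> real) \<Rightarrow> real ^ 'n \<Rightarrow> real" where
  "partial i f x = frechet_derivative f (at x) (axis i 1)"

(* The entries of the array H^h u are indexed by the N^h lists w = [i_1, ..., i_h] over the
   coordinates 'n; the entry at w is the derivative of u along i_1, ..., i_h. *)
primrec pderivs :: "'n list \<Rightarrow> (real ^ 'n \<Rightarrow> real) \<Rightarrow> real ^ 'n \<Rightarrow> real" where
  "pderivs [] f = f"
| "pderivs (i # w) f = partial i (pderivs w f)"

(* C^infinity on an open set S: every iterated partial derivative is differentiable (hence
   continuous) on S. *)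
definition smooth_on :: "(real ^ 'n) set \<Rightarrow> (real ^ 'n \<Rightarrow> real) \<Rightarrow> bool" where
  "smooth_on S f \<longleftrightarrow> (\<forall>w. \<forall>x\<in>S. pderivs w f differentiable (at x))"

(* C_c^infinity(Q), its elements being extended by zero to the whole space. *)
definition test_functions :: "(real ^ 'n \<Rightarrow> real) set" where
  "test_functions =
     {f. smooth_on UNIV f \<and> compact (closure {x. f x \<noteq> 0}) \<and> closure {x. f x \<noteq> 0} \<subseteq> cube}"

(* Index set of the coordinates of R^K: it is the disjoint union over 1 <= h <= d of the index
   sets of R^(N^h), so it has K = N + N^2 + ... + N^d elements.  A vector of R^K is a function
   on lists whose values outside this set are never used; its Euclidean norm is
   L2_set y (multi_indices d). *)
definition multi_indices :: "nat \<Rightarrow> 'n list set" where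
  "multi_indices d = {w. 1 \<le> length w \<and> length w \<le> d}"

definition vector_test_functions :: "nat \<Rightarrow> (real ^ 'n \<Rightarrow> 'n list \<Rightarrow> real) set" where
  "vector_test_functions d = {\<phi>. \<forall>w\<in>multi_indices d. (\<lambda>x. \<phi> x w) \<in> test_functions}"

(* An operator in Pi^d is given by its matrices: B h w v is the (w, v) entry of B^h, for lists
   w, v of length h and 1 <= h <= d.  On smooth u, pde_op B u x w is the w-th coordinate of
   (B^1 H^1 u, ..., B^d H^d u) at x. *)
definition pde_op ::
  "(nat \<Rightarrow> 'n list \<Rightarrow> 'n list \<Rightarrow> real) \<Rightarrow> (real ^ 'n \<Rightarrow> real) \<Rightarrow> real ^ 'n \<Rightarrow> 'n list \<Rightarrow> real" where
  "pde_op B u x w = (\<Sum>v | length v = length w. B (length w) w v * pderivs v u x)"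

(* The description is proper.  Existence: integrating by parts, the sum over 1 <= h <= d and
   lists w, v of length h of (-1)^h * B h w v * (derivative of the w-th coordinate of phi
   along v) has the property.  Uniqueness: test with u equal to the difference of two
   candidates. *)
definition formal_adjoint ::
  "nat \<Rightarrow> (nat \<Rightarrow> 'n list \<Rightarrow> 'n list \<Rightarrow> real) \<Rightarrow> (real ^ 'n \<Rightarrow> 'n list \<Rightarrow> real) \<Rightarrow>
     real ^ 'n \<Rightarrow> real" where
  "formal_adjoint d B \<phi> =
     (THE g. g \<in> test_functions \<and>
        (\<forall>u. smooth_on cube u \<longrightarrow>
           (LINT x:cube|lebesgue. u x * g x) =
           (LINT x:cube|lebesgue. (\<Sum>w\<in>multi_indices d. \<phi> x w * pde_op B u x w))))"

definition L1_cube :: "(real ^ 'n \<Rightarrow> real) set" where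
  "L1_cube = {u. set_integrable lebesgue cube u}"

(* The total variation PV_B(u), meant for u in L1_cube. *)
definition PV ::
  "nat \<Rightarrow> (nat \<Rightarrow> 'n list \<Rightarrow> 'n list \<Rightarrow> real) \<Rightarrow> (real ^ 'n \<Rightarrow> real) \<Rightarrow> ereal" where
  "PV d B u =
     (SUP \<phi>\<in>{\<phi> \<in> vector_test_functions d. \<forall>x\<in>cube. L2_set (\<phi> x) (multi_indices d) \<le> 1}.
        ereal (LINT x:cube|lebesgue. u x * formal_adjoint d B \<phi> x))"

definition BV ::
  "nat \<Rightarrow> (nat \<Rightarrow> 'n list \<Rightarrow> 'n list \<Rightarrow> real) \<Rightarrow> (real ^ 'n \<Rightarrow> real) set" where
  "BV d B = {u \<in> L1_cube. PV d B u < \<infinity>}"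

(* On a bounded set, where Lebesgue measure is finite and without atoms, this epsilon-delta
   condition already implies a uniform bound on the integrals of |u n| over C. *)
definition uniformly_integrable_on :: "(nat \<Rightarrow> real ^ 'n \<Rightarrow> real) \<Rightarrow> (real ^ 'n) set \<Rightarrow> bool" where
  "uniformly_integrable_on u C \<longleftrightarrow>
     (\<forall>e>0. \<exists>\<delta>>0. \<forall>n. \<forall>E\<in>sets lebesgue. E \<subseteq> C \<and> measure lebesgue E < \<delta> \<longrightarrow>
        (LINT x:E|lebesgue. \<bar>u n x\<bar>) < e)"

definition locally_uniformly_integrable :: "(nat \<Rightarrow> real ^ 'n \<Rightarrow> real) \<Rightarrow> bool" where
  "locally_uniformly_integrable u \<longleftrightarrow>
     (\<forall>C. compact C \<and> C \<subseteq> cube \<longrightarrow> uniformly_integrable_on u C)"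

(* C_0(Q): the continuous functions on Q that vanish at the boundary of Q. *)
definition C0_cube :: "(real ^ 'n \<Rightarrow> real) set" where
  "C0_cube = {\<psi>. continuous_on cube \<psi> \<and> (\<forall>e>0. compact {x\<in>cube. e \<le> \<bar>\<psi> x\<bar>})}"

(* Weak* convergence of the measures u n dx to v dx in M_b(Q), the dual of C_0(Q). *)
definition weak_star_converges :: "(nat \<Rightarrow> real ^ 'n \<Rightarrow> real) \<Rightarrow> (real ^ 'n \<Rightarrow> real) \<Rightarrow> bool" where
  "weak_star_converges u v \<longleftrightarrow>
     (\<forall>\<psi>\<in>C0_cube. (\<lambda>n. LINT x:cube|lebesgue. \<psi> x * u n x)
                    \<longlonglongrightarrow> (LINT x:cube|lebesgue. \<psi> x * v x))"

definition radon_measure_on_cube :: "(real ^ 'n) measure \<Rightarrow> bool" where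
  "radon_measure_on_cube \<mu> \<longleftrightarrow>
     sets \<mu> = sets (restrict_space borel cube) \<and>
     (\<forall>C. compact C \<and> C \<subseteq> cube \<longrightarrow> emeasure \<mu> C < \<infinity>) \<and>
     (\<forall>E\<in>sets \<mu>. emeasure \<mu> E = (SUP C\<in>{C. compact C \<and> C \<subseteq> E}. emeasure \<mu> C))"

end

theory Submission
  imports Defs "HOL-Probability.Helly_Selection"
begin

text \<open>Integrating by parts shows that \<open>B\<^sup>*\<phi>\<close> is itself a test function. Hence, for fixed \<open>\<phi>\<close>, the
  pairing of \<open>u\<close> with \<open>B\<^sup>*\<phi>\<close> is continuous under either mode of convergence, and a supremum of
  continuous functionals is lower semicontinuous.

  For the second part, each component of \<open>\<phi> \<mapsto> \<integral> u B\<^sup>*\<phi>\<close> is a linear functional \<open>L\<close> on scalar test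
  functions that is bounded in the supremum norm. A smooth partition of unity \<open>\<zeta>\<^sub>k\<close> on a grid of mesh
  \<open>1/n\<close> approximates \<open>L\<close> by the discrete measures \<open>\<Sum>\<^sub>k L(\<zeta>\<^sub>k) \<delta>\<^bsub>k/n\<^esub>\<close>, whose masses are bounded. Lifting
  the grid points to the line along a space-filling curve reduces weak compactness of these measures to
  Helly's selection theorem, which yields a representing signed measure. The components are then written
  with densities \<open>s\<close> with respect to one finite measure \<open>\<Lambda>\<close>, and \<open>\<mu> = |s| \<Lambda>\<close>, \<open>\<sigma> = - s / |s|\<close>.\<close>

section \<open>Smooth functions\<close>

text \<open>The mass bound is a duality argument: the sum of the \<zeta>_k weighted by the signs of
  L(\<zeta>_k) is a test function bounded by 1, so the numbers |L(\<zeta>_k)| have bounded sum.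
  Positive and negative parts of the weights then converge separately and give a difference of two
  measures. In the limit mass may reach the boundary of the cube. This is harmless, because test
  functions vanish off the open cube; for the same reason missing mass can be supplied by an atom at
  the corner 0, and \<mu> is a restriction to the open cube. The grid stays two layers away from the
  boundary so that every \<zeta>_k has compact support in the cube. A function that is smooth on the
  open cube may blow up at its boundary, so it enters an integral only after multiplication by a
  test function and extension by zero. The adjoint is given by a definite description; an explicit
  formula is shown to be its unique solution. All component densities refer to one measure \<Lambda>
  because \<sigma> is normalised by their pointwise Euclidean norm.\<close>

lemma pderivs_append: "pderivs (v @ w) f = pderivs v (pderivs w f)"
  by (induction v) auto

lemma partial_eqI:
  assumes "(f has_derivative D) (at x)"
  shows "partial i f x = D (axis i 1)"
  using frechet_derivative_at[OF assms] by (simp add: partial_def)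

text \<open>\<open>frechet_derivative\<close> chooses among all derivatives at a point. Functions
  that agree near \<open>x\<close> have the same derivatives there, so the choices coincide, also
  where no derivative exists.\<close>

lemma partial_cong_open:
  assumes "open S" "x \<in> S" "\<And>y. y \<in> S \<Longrightarrow> f y = g y"
  shows "partial i f x = partial i g x"
proof -
  have "(f has_derivative D) (at x) \<longleftrightarrow> (g has_derivative D) (at x)" for D
    using has_derivative_transform_within_open[OF _ assms(1,2), of f D UNIV g]
      has_derivative_transform_within_open[OF _ assms(1,2), of g D UNIV f] assms(3) by auto
  then show ?thesis by (simp add: partial_def frechet_derivative_def)
qed

lemma partial_linear:
  assumes "f differentiable at x" "g differentiable at x"
  shows "partial i (\<lambda>y. a * f y + b * g y) x = a * partial i f x + b * partial i g x"
proof -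
  from assms obtain F G where "(f has_derivative F) (at x)" "(g has_derivative G) (at x)"
    by (auto simp: differentiable_def)
  note FG = this
  have "((\<lambda>y. a * f y + b * g y) has_derivative (\<lambda>h. a * F h + b * G h)) (at x)"
    by (intro derivative_intros FG)
  from partial_eqI[OF this] show ?thesis by (simp add: partial_eqI[OF FG(1)] partial_eqI[OF FG(2)])
qed

lemma partial_mult:
  assumes "f differentiable at x" "g differentiable at x"
  shows "partial i (\<lambda>y. f y * g y) x = partial i f x * g x + f x * partial i g x"
proof -
  from assms obtain F G where "(f has_derivative F) (at x)" "(g has_derivative G) (at x)"
    by (auto simp: differentiable_def)
  note FG = this
  have "((\<lambda>y. f y * g y) has_derivative (\<lambda>h. f x * G h + F h * g x)) (at x)"
    by (intro derivative_intros FG)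
  from partial_eqI[OF this] show ?thesis by (simp add: partial_eqI[OF FG(1)] partial_eqI[OF FG(2)])
qed

text \<open>\<open>pderivs\<close> applies the head of its list last. Peeling off the innermost
  derivative instead turns closure properties into inductions on \<open>n\<close> driven by the rule
  for one derivative.\<close>

primrec Ck :: "nat \<Rightarrow> (real ^ 'n \<Rightarrow> real) \<Rightarrow> bool" where
  "Ck 0 f = True"
| "Ck (Suc n) f = ((\<forall>x. f differentiable at x) \<and> (\<forall>i. Ck n (partial i f)))"

lemma Ck_iff:
  fixes f :: "real ^ 'n \<Rightarrow> real"
  shows "Ck n f \<longleftrightarrow> (\<forall>w. length w < n \<longrightarrow> (\<forall>x. pderivs w f differentiable at x))"
proof (induction n arbitrary: f)
  case (Suc n)
  \<comment> \<open>Lists are split at their last entry, which is the derivative taken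
    first.\<close>
  have "(\<forall>w. length w < Suc n \<longrightarrow> P w) \<longleftrightarrow> P [] \<and> (\<forall>i w. length w < n \<longrightarrow> P (w @ [i]))"
    for P :: "'n list \<Rightarrow> bool"
  proof safe
    fix w :: "'n list" assume "P []" "\<forall>i w. length w < n \<longrightarrow> P (w @ [i])" "length w < Suc n"
    then show "P w" by (cases w rule: rev_cases) auto
  qed auto
  from this[of "\<lambda>w. \<forall>x. pderivs w f differentiable at x"] Suc show ?case
    by (simp add: pderivs_append)
qed simp

lemma smooth_on_UNIV_iff: "smooth_on UNIV f \<longleftrightarrow> (\<forall>n. Ck n f)"
  by (auto simp: smooth_on_def Ck_iff)

lemma Ck_Suc_imp: "Ck (Suc n) f \<Longrightarrow> Ck n f"
  by (simp add: Ck_iff)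

lemma Ck_const: "Ck n (\<lambda>x :: real ^ 'n. c)"
proof (induction n arbitrary: c)
  case (Suc n)
  have *: "partial i (\<lambda>x. c) = (\<lambda>x :: real ^ 'n. 0)" for i
    by (rule ext, subst partial_eqI[OF has_derivative_const]) simp
  show ?case unfolding Ck.simps * using Suc by simp
qed simp

lemma Ck_linear: "Ck n f \<Longrightarrow> Ck n g \<Longrightarrow> Ck n (\<lambda>x. a * f x + b * g x)"
proof (induction n arbitrary: f g)
  case (Suc n)
  then have "partial i (\<lambda>x. a * f x + b * g x) = (\<lambda>x. a * partial i f x + b * partial i g x)" for i
    by (intro ext partial_linear) auto
  with Suc show ?case by (auto intro!: derivative_intros)
qed simp

lemma Ck_mult: "Ck n f \<Longrightarrow> Ck n g \<Longrightarrow> Ck n (\<lambda>x. f x * g x)"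
proof (induction n arbitrary: f g)
  case (Suc n)
  \<comment> \<open>The coefficients 1 make the product rule an instance of
    \<open>Ck_linear\<close>.\<close>
  then have *: "partial i (\<lambda>x. f x * g x) = (\<lambda>x. 1 * (partial i f x * g x) + 1 * (f x * partial i g x))" for i
    by (intro ext, subst partial_mult) auto
  have "Ck n (\<lambda>x. partial i f x * g x)" "Ck n (\<lambda>x. f x * partial i g x)" for i
    using Suc Ck_Suc_imp[OF Suc.prems(1)] Ck_Suc_imp[OF Suc.prems(2)] by auto
  then show ?case using Suc.prems unfolding Ck.simps *
    by (intro conjI allI Ck_linear) (auto intro!: derivative_intros)
qed simp

lemma Ck_prod: "finite I \<Longrightarrow> (\<And>i. i \<in> I \<Longrightarrow> Ck n (f i)) \<Longrightarrow> Ck n (\<lambda>x. \<Prod>i\<in>I. f i x)"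
  by (induction I rule: finite_induct) (auto intro: Ck_const Ck_mult)

section \<open>Smooth functions of one variable\<close>

primrec Ck_real :: "nat \<Rightarrow> (real \<Rightarrow> real) \<Rightarrow> bool" where
  "Ck_real 0 h = True"
| "Ck_real (Suc n) h = (\<exists>h'. (\<forall>t. (h has_real_derivative h' t) (at t)) \<and> Ck_real n h')"

lemma Ck_real_Suc_imp: "Ck_real (Suc n) h \<Longrightarrow> Ck_real n h"
  by (induction n arbitrary: h) (simp, metis Ck_real.simps(2))

lemma Ck_real_const: "Ck_real n (\<lambda>t. c)"
  by (induction n arbitrary: c) (auto intro!: exI[of _ "\<lambda>t. 0"])

lemma Ck_real_add: "Ck_real n f \<Longrightarrow> Ck_real n g \<Longrightarrow> Ck_real n (\<lambda>t. f t + g t)"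
proof (induction n arbitrary: f g)
  case (Suc n)
  then obtain f' g' where "\<And>t. (f has_real_derivative f' t) (at t)" "Ck_real n f'"
    "\<And>t. (g has_real_derivative g' t) (at t)" "Ck_real n g'" by auto
  with Suc.IH show ?case by (auto intro!: exI[of _ "\<lambda>t. f' t + g' t"] derivative_intros)
qed simp

lemma Ck_real_mult: "Ck_real n f \<Longrightarrow> Ck_real n g \<Longrightarrow> Ck_real n (\<lambda>t. f t * g t)"
proof (induction n arbitrary: f g)
  case (Suc n)
  then obtain f' g' where *: "\<And>t. (f has_real_derivative f' t) (at t)" "Ck_real n f'"
    "\<And>t. (g has_real_derivative g' t) (at t)" "Ck_real n g'" by auto
  have "Ck_real n (\<lambda>t. f' t * g t + g' t * f t)"
    using * Suc Ck_real_Suc_imp[OF Suc.prems(1)] Ck_real_Suc_imp[OF Suc.prems(2)]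
    by (intro Ck_real_add) auto
  with * show ?case by (auto intro!: exI[of _ "\<lambda>t. f' t * g t + g' t * f t"] DERIV_mult)
qed simp

text \<open>The derivative of \<open>1/f\<close> is minus the product of \<open>1/f\<close>,
  \<open>f'\<close> and \<open>1/f\<close>, so \<open>n\<close> orders of smoothness for
  \<open>1/f\<close> and \<open>f'\<close> give order \<open>n + 1\<close> for
  \<open>1/f\<close>.\<close>

lemma Ck_real_inverse:
  assumes "\<And>t. f t > 0"
  shows "Ck_real n f \<Longrightarrow> Ck_real n (\<lambda>t. inverse (f t))"
proof (induction n)
  case (Suc n)
  then obtain f' where *: "\<And>t. (f has_real_derivative f' t) (at t)" "Ck_real n f'" by auto
  have "Ck_real n (\<lambda>t. - 1 * (inverse (f t) * f' t * inverse (f t)))"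
    using Suc.IH[OF Ck_real_Suc_imp[OF Suc.prems]] * by (intro Ck_real_mult Ck_real_const) auto
  moreover have "((\<lambda>t. inverse (f t)) has_real_derivative - 1 * (inverse (f t) * f' t * inverse (f t))) (at t)" for t
    using DERIV_inverse'[OF *(1)[of t]] assms[of t] by simp
  ultimately show ?case by (auto intro!: exI[of _ "\<lambda>t. - 1 * (inverse (f t) * f' t * inverse (f t))"])
qed simp

lemma Ck_real_affine: "Ck_real n f \<Longrightarrow> Ck_real n (\<lambda>t. f (a * t + b))"
proof (induction n arbitrary: f)
  case (Suc n)
  then obtain f' where *: "\<And>t. (f has_real_derivative f' t) (at t)" "Ck_real n f'" by auto
  have "((\<lambda>t. f (a * t + b)) has_real_derivative f' (a * t + b) * a) (at t)" for t
    by (rule DERIV_chain2[OF *(1)]) (auto intro!: derivative_eq_intros)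
  moreover have "Ck_real n (\<lambda>t. f' (a * t + b) * a)"
    using Suc.IH[OF *(2)] by (intro Ck_real_mult Ck_real_const)
  ultimately show ?case by (auto intro!: exI[of _ "\<lambda>t. f' (a * t + b) * a"])
qed simp

lemma Ck_component:
  fixes i :: "'n::finite"
  shows "Ck_real n h \<Longrightarrow> Ck n (\<lambda>x. h (x $ i))"
proof (induction n arbitrary: h)
  case (Suc n)
  then obtain h' where *: "\<And>t. (h has_real_derivative h' t) (at t)" "Ck_real n h'" by auto
  have der: "((\<lambda>x. h (x $ i)) has_derivative (\<lambda>y. h' (x $ i) * (y $ i))) (at x)" for x :: "real ^ 'n"
    by (rule has_derivative_compose[OF bounded_linear.has_derivative[OF bounded_linear_vec_nth has_derivative_ident]
        *(1)[unfolded has_field_derivative_def]])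
  have eq: "partial j (\<lambda>x. h (x $ i)) = (\<lambda>x. h' (x $ i) * axis j 1 $ i)" for j :: 'n
    by (rule ext) (rule partial_eqI[OF der])
  have "Ck n (\<lambda>x. h' (x $ i) * axis j 1 $ i)" for j :: 'n
    using Suc.IH[OF *(2)] by (intro Ck_mult Ck_const)
  then show ?case using der unfolding Ck.simps eq by (auto simp: differentiable_def)
qed simp

text \<open>The flat function \<open>exp (- 1 / t)\<close> of Cauchy with a polynomial factor in
  \<open>1/t\<close>. The polynomial parameter makes the family closed under differentiation, so
  that smoothness is a single induction.\<close>

definition flat :: "real poly \<Rightarrow> real \<Rightarrow> real" where
  "flat p t = (if t \<le> 0 then 0 else poly p (1 / t) * exp (- (1 / t)))"

lemma poly_exp_tendsto_0: "((\<lambda>y::real. poly p y * exp (- y)) \<longlongrightarrow> 0) at_top"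
proof -
  have "((\<lambda>y::real. \<Sum>i\<le>degree p. coeff p i * (y ^ i / exp y)) \<longlongrightarrow> (\<Sum>i\<le>degree p. coeff p i * 0)) at_top"
    by (intro tendsto_intros tendsto_power_div_exp_0)
  then show ?thesis
    by (simp add: poly_altdef sum_distrib_right exp_minus divide_inverse mult.assoc)
qed

lemma flat_tendsto_0: "(flat p \<longlongrightarrow> 0) (at_right 0)"
proof -
  have "((\<lambda>t. poly p (1 / t) * exp (- (1 / t))) \<longlongrightarrow> 0) (at_right 0)"
    using filterlim_compose[OF poly_exp_tendsto_0 filterlim_inverse_at_top_right, of p]
    by (simp add: inverse_eq_divide)
  then show ?thesis
    by (rule Lim_transform_eventually) (auto simp: flat_def eventually_at_filter)
qed

text \<open>With \<open>s = 1/t\<close>, whose derivative is \<open>- s^2\<close>, the chain rule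
  turns \<open>p s * exp (- s)\<close> into \<open>s^2 * (p s - p' s) * exp (- s)\<close>; hence the
  factor \<open>[:0, 0, 1:]\<close>.\<close>

lemma DERIV_flat: "(flat p has_real_derivative flat ([:0, 0, 1:] * (p - pderiv p)) t) (at t)"
proof -
  consider "t < 0" | "t = 0" | "t > 0" by linarith
  then show ?thesis
  proof cases
    case 1
    have "((\<lambda>t. 0) has_real_derivative 0) (at t)" by simp
    then have "(flat p has_real_derivative 0) (at t)"
      by (rule has_field_derivative_transform_within_open[of _ _ _ "{..<0}"]) (use 1 in \<open>auto simp: flat_def\<close>)
    with 1 show ?thesis by (simp add: flat_def)
  next
    case 2
    \<comment> \<open>For positive \<open>h\<close> the quotient \<open>flat p h / h\<close> is
      again a flat function, with the polynomial X p, and so tends to 0.\<close>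
    have "((\<lambda>h. (flat p (0 + h) - flat p 0) / h) \<longlongrightarrow> 0) (at_right 0)"
      by (rule Lim_transform_eventually[OF flat_tendsto_0[of "[:0, 1:] * p"]])
         (auto simp: flat_def eventually_at_filter)
    moreover have "((\<lambda>h. (flat p (0 + h) - flat p 0) / h) \<longlongrightarrow> 0) (at_left 0)"
      by (rule Lim_transform_eventually[OF tendsto_const]) (auto simp: flat_def eventually_at_filter)
    ultimately show ?thesis
      using 2 by (auto simp: DERIV_def flat_def[of _ 0] intro: filterlim_split_at)
  next
    case 3
    have "((\<lambda>t. poly p (1 / t) * exp (- (1 / t))) has_real_derivative
        flat ([:0, 0, 1:] * (p - pderiv p)) t) (at t)"
      using 3 by (auto intro!: derivative_eq_intros DERIV_chain2[OF poly_DERIV] simp: flat_def power2_eq_square field_simps)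
    then show ?thesis
      by (rule has_field_derivative_transform_within_open[of _ _ _ "{0<..}"]) (use 3 in \<open>auto simp: flat_def\<close>)
  qed
qed

lemma Ck_real_flat: "Ck_real n (flat p)"
  by (induction n arbitrary: p) (auto intro!: exI DERIV_flat)

text \<open>The classical smooth transition from 0 on \<open>t \<le> 0\<close> to 1 on
  \<open>t \<ge> 1\<close>. One of \<open>t\<close> and \<open>1 - t\<close> is always positive, so
  the denominator never vanishes.\<close>

definition smooth_step :: "real \<Rightarrow> real" where
  "smooth_step t = flat 1 t * inverse (flat 1 t + flat 1 (1 - t))"

lemma flat_1_nonneg: "flat 1 t \<ge> 0" and flat_1_pos: "t > 0 \<Longrightarrow> flat 1 t > 0"
  and flat_1_eq_0: "t \<le> 0 \<Longrightarrow> flat 1 t = 0"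
  by (auto simp: flat_def)

lemma smooth_step_denom: "flat 1 t + flat 1 (1 - t) > 0"
proof (cases "t > 0")
  case True
  then show ?thesis by (intro add_pos_nonneg flat_1_pos flat_1_nonneg)
next
  case False
  then show ?thesis by (intro add_nonneg_pos flat_1_pos flat_1_nonneg) auto
qed

lemma Ck_real_smooth_step: "Ck_real n smooth_step"
proof -
  have "Ck_real n (\<lambda>t. flat 1 (1 - t))"
    using Ck_real_affine[OF Ck_real_flat, of n 1 "-1" 1] by simp
  then show ?thesis unfolding smooth_step_def
    by (intro Ck_real_mult Ck_real_inverse Ck_real_add Ck_real_flat smooth_step_denom)
qed

lemma smooth_step_nonneg: "smooth_step t \<ge> 0"
  using smooth_step_denom[of t] flat_1_nonneg[of t] by (simp add: smooth_step_def)

lemma smooth_step_le_1: "smooth_step t \<le> 1"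
  using smooth_step_denom[of t] flat_1_nonneg[of "1 - t"] by (simp add: smooth_step_def field_simps)

lemma smooth_step_eq_0: "t \<le> 0 \<Longrightarrow> smooth_step t = 0"
  by (simp add: smooth_step_def flat_1_eq_0)

lemma smooth_step_eq_1: "t \<ge> 1 \<Longrightarrow> smooth_step t = 1"
  using smooth_step_denom[of t] by (simp add: smooth_step_def flat_1_eq_0)

section \<open>Test functions and integration by parts\<close>

lemma open_cube: "open (cube :: (real ^ 'n) set)"
proof -
  have "cube = (\<Inter>i. {x :: real ^ 'n. 0 < x $ i} \<inter> {x. x $ i < 1})"
    by (auto simp: cube_def)
  show ?thesis unfolding \<open>cube = _\<close>
    by (auto intro!: open_INT open_Int open_halfspace_component_lt_cart open_halfspace_component_gt_cart)
qed

lemma test_functionsI: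
  assumes "\<And>n. Ck n f" "compact K" "K \<subseteq> cube" "\<And>x. x \<notin> K \<Longrightarrow> f x = 0"
  shows "f \<in> test_functions"
proof -
  have "closure {x. f x \<noteq> 0} \<subseteq> K"
    using assms by (intro closure_minimal compact_imp_closed) auto
  moreover from this have "compact (closure {x. f x \<noteq> 0})"
    using compact_Int_closed[OF assms(2) closed_closure, of "{x. f x \<noteq> 0}"] by (simp add: Int_absorb1)
  ultimately show ?thesis using assms(1,3)
    by (simp add: test_functions_def smooth_on_UNIV_iff)
qed

lemma test_functionsE:
  assumes "f \<in> test_functions"
  obtains K where "\<And>n. Ck n f" "compact K" "K \<subseteq> cube" "\<And>x. x \<notin> K \<Longrightarrow> f x = 0"
proof (rule that[of "closure {x. f x \<noteq> 0}"])
  show "f x = 0" if "x \<notin> closure {x. f x \<noteq> 0}" for x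
    using that closure_subset[of "{x. f x \<noteq> 0}"] by auto
qed (use assms in \<open>auto simp: test_functions_def smooth_on_UNIV_iff\<close>)

lemma test_functions_zero_outside: "f \<in> test_functions \<Longrightarrow> x \<notin> cube \<Longrightarrow> f x = 0"
  by (elim test_functionsE) auto

lemma test_functions_differentiable: "f \<in> test_functions \<Longrightarrow> f differentiable at x"
  by (elim test_functionsE) (metis Ck.simps(2))

lemma test_functions_continuous: "f \<in> test_functions \<Longrightarrow> continuous_on S f"
  by (simp add: continuous_at_imp_continuous_on differentiable_imp_continuous_within test_functions_differentiable)

lemma test_functions_linear:
  assumes "f \<in> test_functions" "g \<in> test_functions"
  shows "(\<lambda>x. a * f x + b * g x) \<in> test_functions"
proof -
  obtain K where K: "\<And>n. Ck n f" "compact K" "K \<subseteq> cube" "\<And>x. x \<notin> K \<Longrightarrow> f x = 0"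
    using test_functionsE[OF assms(1)] by blast
  obtain L where L: "\<And>n. Ck n g" "compact L" "L \<subseteq> cube" "\<And>x. x \<notin> L \<Longrightarrow> g x = 0"
    using test_functionsE[OF assms(2)] by blast
  show ?thesis
    by (rule test_functionsI[of _ "K \<union> L"]) (use K L in \<open>auto intro: Ck_linear\<close>)
qed

lemma test_functions_zero: "(\<lambda>x. 0) \<in> test_functions"
  by (rule test_functionsI[of _ "{}"]) (auto intro: Ck_const)

lemma test_functions_cmult: "f \<in> test_functions \<Longrightarrow> (\<lambda>x. a * f x) \<in> test_functions"
  using test_functions_linear[OF _ test_functions_zero, of f a 0] by simp

lemma test_functions_sum:
  assumes "finite I" "\<And>i. i \<in> I \<Longrightarrow> f i \<in> test_functions"
  shows "(\<lambda>x. \<Sum>i\<in>I. f i x) \<in> test_functions"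
  using assms
proof (induction I rule: finite_induct)
  case (insert j I)
  then show ?case using test_functions_linear[of "f j" "\<lambda>x. \<Sum>i\<in>I. f i x" 1 1] by simp
qed (simp add: test_functions_zero)

lemma test_functions_partial:
  assumes "f \<in> test_functions"
  shows "partial i f \<in> test_functions"
proof -
  obtain K where K: "\<And>n. Ck n f" "compact K" "K \<subseteq> cube" "\<And>x. x \<notin> K \<Longrightarrow> f x = 0"
    using test_functionsE[OF assms] by blast
  have "partial i f x = 0" if "x \<notin> K" for x
  proof -
    have "partial i f x = partial i (\<lambda>x. 0) x"
      by (rule partial_cong_open[of "- K"]) (use K that in \<open>auto simp: compact_imp_closed open_Compl\<close>)
    then show ?thesis by (simp add: partial_eqI[OF has_derivative_const])
  qed
  moreover have "Ck n (partial i f)" for n using K(1)[of "Suc n"] by simp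
  ultimately show ?thesis by (intro test_functionsI[of _ K] K)
qed

lemma test_functions_pderivs: "f \<in> test_functions \<Longrightarrow> pderivs w f \<in> test_functions"
  by (induction w) (auto intro: test_functions_partial)

lemma DERIV_along_axis:
  assumes "F differentiable at (x + t *\<^sub>R axis i 1)"
  shows "((\<lambda>t. F (x + t *\<^sub>R axis i 1)) has_real_derivative partial i F (x + t *\<^sub>R axis i 1)) (at t)"
proof -
  obtain D where D: "(F has_derivative D) (at (x + t *\<^sub>R axis i 1))"
    using assms by (auto simp: differentiable_def)
  then interpret bounded_linear D by (rule has_derivative_bounded_linear)
  have "((\<lambda>t. x + t *\<^sub>R axis i 1) has_derivative (\<lambda>h. h *\<^sub>R axis i 1)) (at t)"
    by (auto intro!: derivative_eq_intros)
  from has_derivative_compose[OF this D]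
  have "((\<lambda>t. F (x + t *\<^sub>R axis i 1)) has_derivative (\<lambda>h. D (h *\<^sub>R axis i 1))) (at t)" .
  moreover have "(\<lambda>h. D (h *\<^sub>R axis i 1)) = (*) (partial i F (x + t *\<^sub>R axis i 1))"
    by (auto simp: partial_eqI[OF D] scaleR)
  ultimately show ?thesis by (simp add: has_field_derivative_def)
qed

lemma integrable_lborel_compact_support:
  fixes f :: "'a::euclidean_space \<Rightarrow> real"
  assumes "continuous_on UNIV f" "compact K" "\<And>x. x \<notin> K \<Longrightarrow> f x = 0"
  shows "integrable lborel f"
proof -
  have "integrable lborel (\<lambda>x. indicator K x *\<^sub>R f x)"
    by (intro borel_integrable_compact continuous_on_subset[OF assms(1)] assms) auto
  moreover have "(\<lambda>x. indicator K x *\<^sub>R f x) = f"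
    using assms(3) by (auto simp: fun_eq_iff indicator_def)
  ultimately show ?thesis by simp
qed

lemma bounded_compact_support:
  fixes f :: "'a::euclidean_space \<Rightarrow> real"
  assumes "continuous_on UNIV f" "compact K" "\<And>x. x \<notin> K \<Longrightarrow> f x = 0"
  obtains B where "\<And>x. \<bar>f x\<bar> \<le> B" "B > 0"
proof -
  have "compact (f ` K)" by (intro compact_continuous_image continuous_on_subset[OF assms(1)] assms) auto
  then obtain b where b: "b > 0" "\<forall>y\<in>f ` K. norm y \<le> b"
    using compact_imp_bounded bounded_pos by metis
  have "\<bar>f x\<bar> \<le> b" for x using b assms(3)[of x] by (cases "x \<in> K") auto
  with b show ?thesis by (intro that) auto
qed

text \<open>The difference quotients of \<open>F\<close> have integral zero by translation invariance and converge
  dominatedly, so no iterated integrals are needed.\<close>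

lemma integral_partial_eq_0:
  fixes F :: "real ^ 'n \<Rightarrow> real"
  assumes F: "\<And>x. F differentiable at x" and c: "continuous_on UNIV (partial i F)"
    and K: "compact K" "\<And>x. x \<notin> K \<Longrightarrow> F x = 0"
  shows "integral\<^sup>L lborel (partial i F) = 0"
proof -
  define e :: "real ^ 'n" where "e = axis i 1"
  have ne: "norm e = 1" by (simp add: e_def)
  have Fc: "continuous_on UNIV F"
    by (simp add: F continuous_at_imp_continuous_on differentiable_imp_continuous_within)
  have G0: "partial i F x = 0" if "x \<notin> K" for x
  proof -
    have "partial i F x = partial i (\<lambda>x. 0) x"
      by (rule partial_cong_open[of "- K"]) (use K that in \<open>auto simp: compact_imp_closed open_Compl\<close>)
    then show ?thesis by (simp add: partial_eqI[OF has_derivative_const])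
  qed
  obtain B where B: "\<And>x. \<bar>partial i F x\<bar> \<le> B" "B > 0"
    using bounded_compact_support[OF c K(1) G0] by blast
  obtain R where R: "\<And>x. x \<in> K \<Longrightarrow> norm x \<le> R"
    using compact_imp_bounded[OF K(1)] by (auto simp: bounded_iff)
  define s where "s n x = real (Suc n) * (F (x + (1 / real (Suc n)) *\<^sub>R e) - F x)" for n x
  have int: "integrable lborel F" by (rule integrable_lborel_compact_support[OF Fc K])
  have shift: "integral\<^sup>L lborel (\<lambda>x. F (x + a)) = integral\<^sup>L lborel F"
    "integrable lborel (\<lambda>x. F (x + a))" for a
  proof -
    have Fm: "F \<in> borel_measurable borel" using Fc by (rule borel_measurable_continuous_onI)
    have "integral\<^sup>L (distr lborel borel ((+) a)) F = integral\<^sup>L lborel (\<lambda>x. F (a + x))"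
      by (rule integral_distr) (use Fm in auto)
    then show "integral\<^sup>L lborel (\<lambda>x. F (x + a)) = integral\<^sup>L lborel F"
      by (simp add: lborel_distr_plus add.commute)
    have "integrable (distr lborel borel ((+) a)) F \<longleftrightarrow> integrable lborel (\<lambda>x. F (a + x))"
      by (rule integrable_distr_eq) (use Fm in auto)
    then show "integrable lborel (\<lambda>x. F (x + a))"
      using int by (simp add: lborel_distr_plus add.commute)
  qed
  have "(\<lambda>n. integral\<^sup>L lborel (s n)) \<longlonglongrightarrow> integral\<^sup>L lborel (partial i F)"
  \<comment> \<open>By the mean value theorem each quotient is a value of
    \<open>partial i F\<close>, hence at most \<open>B\<close>. The steps have length at most 1, so
    the quotients vanish outside the ball of radius \<open>R + 1\<close>.\<close>
  proof (rule integral_dominated_convergence[where w = "\<lambda>x. indicator (cball 0 (R + 1)) x *\<^sub>R B"])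
    show "partial i F \<in> borel_measurable lborel"
      using borel_measurable_continuous_onI[OF c] by simp
    show "s n \<in> borel_measurable lborel" for n
      unfolding s_def using shift(2)[THEN borel_measurable_integrable] int[THEN borel_measurable_integrable]
      by (intro borel_measurable_times borel_measurable_diff borel_measurable_const)
    show "integrable lborel (\<lambda>x. indicator (cball 0 (R + 1)) x *\<^sub>R B)"
      by (intro borel_integrable_compact) auto
    show "AE x in lborel. (\<lambda>n. s n x) \<longlonglongrightarrow> partial i F x"
    proof (rule AE_I2)
      fix x
      have "((\<lambda>t. F (x + t *\<^sub>R e)) has_real_derivative partial i F x) (at 0)"
        using DERIV_along_axis[of F x 0 i] F by (simp add: e_def)
      then have "((\<lambda>t. (F (x + t *\<^sub>R e) - F x) / t) \<longlongrightarrow> partial i F x) (at 0)"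
        by (simp add: DERIV_def)
      moreover have "filterlim (\<lambda>n. 1 / real (Suc n)) (at 0) sequentially"
        unfolding filterlim_at using LIMSEQ_Suc[OF lim_1_over_n] by auto
      ultimately have "(\<lambda>n. (F (x + (1 / real (Suc n)) *\<^sub>R e) - F x) / (1 / real (Suc n))) \<longlonglongrightarrow> partial i F x"
        by (rule filterlim_compose)
      then show "(\<lambda>n. s n x) \<longlonglongrightarrow> partial i F x"
        by (simp add: s_def mult.commute)
    qed
    show "AE x in lborel. norm (s n x) \<le> indicator (cball 0 (R + 1)) x *\<^sub>R B" for n
    proof (rule AE_I2)
      fix x
      define t where "t = 1 / real (Suc n)"
      have t: "0 < t" "t \<le> 1" by (auto simp: t_def)
      show "norm (s n x) \<le> indicator (cball 0 (R + 1)) x *\<^sub>R B"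
      proof (cases "x \<in> cball 0 (R + 1)")
        case True
        have "\<exists>z>0. z < t \<and> F (x + t *\<^sub>R e) - F (x + 0 *\<^sub>R e) = (t - 0) * partial i F (x + z *\<^sub>R e)"
          unfolding e_def by (rule MVT2[OF t(1)]) (intro DERIV_along_axis F)
        then obtain z where "F (x + t *\<^sub>R e) - F x = t * partial i F (x + z *\<^sub>R e)" by auto
        then have "s n x = partial i F (x + z *\<^sub>R e)" using t by (simp add: s_def t_def)
        with B True show ?thesis by simp
      next
        case False
        then have nx: "norm x > R + 1" by simp
        moreover have "norm (x + t *\<^sub>R e) \<ge> norm x - 1"
          using norm_triangle_ineq2[of x "- (t *\<^sub>R e)"] t ne by simp
        ultimately have "x \<notin> K" "x + t *\<^sub>R e \<notin> K" using R[of x] R[of "x + t *\<^sub>R e"] by linarith+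
        then show ?thesis using K(2) False by (simp add: s_def t_def)
      qed
    qed
  qed
  moreover have "integral\<^sup>L lborel (s n) = 0" for n
    unfolding s_def using int shift by (simp add: Bochner_Integration.integral_diff)
  ultimately have "(\<lambda>n. 0) \<longlonglongrightarrow> integral\<^sup>L lborel (partial i F)" by simp
  from LIMSEQ_unique[OF tendsto_const this] show ?thesis by simp
qed

text \<open>The open cube and the complement of the compact set carrying \<psi> form an open cover
  of the space. On the first the product is continuous, on the second it is zero.\<close>

lemma continuous_on_cutoff:
  fixes g :: "real ^ 'n \<Rightarrow> real"
  assumes "continuous_on cube g" "\<psi> \<in> test_functions"
  shows "continuous_on UNIV (\<lambda>x. indicator cube x * (g x * \<psi> x))"
proof -
  obtain K where K: "compact K" "K \<subseteq> cube" "\<And>x. x \<notin> K \<Longrightarrow> \<psi> x = 0"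
    using test_functionsE[OF assms(2)] by metis
  have "continuous_on (cube \<union> - K) (\<lambda>x. indicator cube x * (g x * \<psi> x))"
  proof (rule continuous_on_open_Un)
    have "continuous_on cube (\<lambda>x. g x * \<psi> x)"
      by (intro continuous_intros assms test_functions_continuous)
    then show "continuous_on cube (\<lambda>x. indicator cube x * (g x * \<psi> x))"
      by (rule continuous_on_eq) simp
    show "continuous_on (- K) (\<lambda>x. indicator cube x * (g x * \<psi> x))"
      by (rule continuous_on_eq[OF continuous_on_const[of _ 0]]) (use K in auto)
  qed (use K open_cube in \<open>auto simp: compact_imp_closed open_Compl\<close>)
  moreover have "cube \<union> - K = UNIV" using K by auto
  ultimately show ?thesis by simp
qed

lemma set_integral_cutoff:
  fixes g :: "real ^ 'n \<Rightarrow> real"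
  assumes "continuous_on cube g" "\<psi> \<in> test_functions"
  shows "set_integrable lebesgue cube (\<lambda>x. g x * \<psi> x)"
    and "integrable lborel (\<lambda>x. indicator cube x * (g x * \<psi> x))"
    and "(LINT x:cube|lebesgue. g x * \<psi> x) = integral\<^sup>L lborel (\<lambda>x. indicator cube x * (g x * \<psi> x))"
proof -
  obtain K where K: "compact K" "K \<subseteq> cube" "\<And>x. x \<notin> K \<Longrightarrow> \<psi> x = 0"
    using test_functionsE[OF assms(2)] by metis
  note c = continuous_on_cutoff[OF assms]
  show i: "integrable lborel (\<lambda>x. indicator cube x * (g x * \<psi> x))"
    by (rule integrable_lborel_compact_support[OF c K(1)]) (use K in auto)
  then show "set_integrable lebesgue cube (\<lambda>x. g x * \<psi> x)"
    using borel_measurable_continuous_onI[OF c] by (simp add: set_integrable_def integrable_completion)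
  show "(LINT x:cube|lebesgue. g x * \<psi> x) = integral\<^sup>L lborel (\<lambda>x. indicator cube x * (g x * \<psi> x))"
    using borel_measurable_continuous_onI[OF c] by (simp add: set_lebesgue_integral_def integral_completion)
qed

text \<open>Extended by zero from the cube, the product of \<open>v\<close> and \<psi> is
  differentiable everywhere, with compact support and continuous \<open>i\<close>-th partial
  derivative. That derivative has integral zero, and the product rule splits it.\<close>

lemma integration_by_parts:
  fixes v :: "real ^ 'n \<Rightarrow> real"
  assumes v: "\<And>x. x \<in> cube \<Longrightarrow> v differentiable at x" and c: "continuous_on cube (partial i v)"
    and \<psi>: "\<psi> \<in> test_functions"
  shows "(LINT x:cube|lebesgue. partial i v x * \<psi> x) = - (LINT x:cube|lebesgue. v x * partial i \<psi> x)"
proof -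
  obtain K where K: "compact K" "K \<subseteq> cube" "\<And>x. x \<notin> K \<Longrightarrow> \<psi> x = 0"
    using test_functionsE[OF \<psi>] by metis
  define F where "F x = indicator cube x * (v x * \<psi> x)" for x
  have vc: "continuous_on cube v"
    by (simp add: continuous_at_imp_continuous_on differentiable_imp_continuous_within v)
  have F_eq: "F x = v x * \<psi> x" if "x \<in> cube" for x using that by (simp add: F_def)
  have F_0: "F x = 0" if "x \<notin> K" for x using that K by (simp add: F_def)
  have oK: "open (- K)" using K by (simp add: compact_imp_closed open_Compl)
  have dF: "F differentiable at x" for x
  proof (cases "x \<in> cube")
    case True
    have "(\<lambda>x. v x * \<psi> x) differentiable at x"
      by (intro differentiable_mult v True test_functions_differentiable \<psi>)
    then obtain D where "((\<lambda>x. v x * \<psi> x) has_derivative D) (at x)" by (auto simp: differentiable_def)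
    then have "(F has_derivative D) (at x)"
      by (rule has_derivative_transform_within_open[OF _ open_cube True]) (simp add: F_eq)
    then show ?thesis by (auto simp: differentiable_def)
  next
    case False
    then have "(F has_derivative (\<lambda>h. 0)) (at x)"
      by (intro has_derivative_transform_within_open[OF has_derivative_const[of 0] oK]) (use K F_0 in auto)
    then show ?thesis by (auto simp: differentiable_def)
  qed
  have pF: "partial i F = (\<lambda>x. indicator cube x * (partial i v x * \<psi> x) + indicator cube x * (v x * partial i \<psi> x))"
  proof
    fix x
    show "partial i F x = indicator cube x * (partial i v x * \<psi> x) + indicator cube x * (v x * partial i \<psi> x)"
    proof (cases "x \<in> cube")
      case True
      have "partial i F x = partial i (\<lambda>x. v x * \<psi> x) x"
        by (rule partial_cong_open[OF open_cube True]) (simp add: F_eq)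
      with True show ?thesis by (simp add: partial_mult v test_functions_differentiable[OF \<psi>])
    next
      case False
      have "partial i F x = partial i (\<lambda>x. 0) x"
        by (rule partial_cong_open[OF oK]) (use False K F_0 in auto)
      with False show ?thesis by (simp add: partial_eqI[OF has_derivative_const])
    qed
  qed
  note p = test_functions_partial[OF \<psi>, of i]
  have "continuous_on UNIV (partial i F)"
    unfolding pF by (intro continuous_on_add continuous_on_cutoff c vc \<psi> p)
  then have "integral\<^sup>L lborel (partial i F) = 0"
    by (rule integral_partial_eq_0[OF dF _ K(1) F_0])
  then show ?thesis
    unfolding pF set_integral_cutoff(3)[OF c \<psi>] set_integral_cutoff(3)[OF vc p]
    using set_integral_cutoff(2)[OF c \<psi>] set_integral_cutoff(2)[OF vc p]
    by simp
qed

section \<open>The formal adjoint\<close>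

lemma finite_lists_eq_length: "finite {v :: 'n::finite list. length v = n}"
  using finite_lists_length_eq[of "UNIV :: 'n set" n] by simp

lemma finite_multi_indices: "finite (multi_indices d :: 'n::finite list set)"
  by (rule finite_subset[OF _ finite_lists_length_le[of "UNIV :: 'n set" d]]) (auto simp: multi_indices_def)

lemma test_functions_smooth_on: "f \<in> test_functions \<Longrightarrow> smooth_on S f"
  by (auto simp: test_functions_def smooth_on_def)

lemma smooth_on_continuous_pderivs: "smooth_on S f \<Longrightarrow> continuous_on S (pderivs w f)"
  by (simp add: smooth_on_def continuous_at_imp_continuous_on differentiable_imp_continuous_within)

lemma set_lebesgue_integral_sum:
  fixes f :: "'i \<Rightarrow> 'a \<Rightarrow> real"
  assumes "\<And>i. i \<in> I \<Longrightarrow> set_integrable M A (f i)"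
  shows "(LINT x:A|M. \<Sum>i\<in>I. f i x) = (\<Sum>i\<in>I. LINT x:A|M. f i x)"
  using assms unfolding set_lebesgue_integral_def set_integrable_def
  by (simp add: sum_distrib_left Bochner_Integration.integral_sum)

lemma set_integrable_sum:
  fixes f :: "'i \<Rightarrow> 'a \<Rightarrow> real"
  assumes "\<And>i. i \<in> I \<Longrightarrow> set_integrable M A (f i)"
  shows "set_integrable M A (\<lambda>x. \<Sum>i\<in>I. f i x)"
  using assms unfolding set_integrable_def by (simp add: sum_distrib_left)

text \<open>The outermost derivative of \<open>u\<close> is moved first and so ends up innermost on
  \<psi>; this is why the list is reversed. The induction generalises \<psi> because each step
  replaces it by a partial derivative.\<close>

lemma pderivs_by_parts:
  fixes u :: "real ^ 'n \<Rightarrow> real"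
  assumes u: "smooth_on cube u"
  shows "\<psi> \<in> test_functions \<Longrightarrow> (LINT x:cube|lebesgue. pderivs v u x * \<psi> x) =
      (- 1) ^ length v * (LINT x:cube|lebesgue. u x * pderivs (rev v) \<psi> x)"
proof (induction v arbitrary: \<psi>)
  case (Cons i v)
  have "(LINT x:cube|lebesgue. pderivs (i # v) u x * \<psi> x) =
      - (LINT x:cube|lebesgue. pderivs v u x * partial i \<psi> x)"
    using integration_by_parts[of "pderivs v u" i \<psi>] u smooth_on_continuous_pderivs[OF u, of "i # v"] Cons.prems
    by (auto simp: smooth_on_def)
  also have "\<dots> = (- 1) ^ length (i # v) * (LINT x:cube|lebesgue. u x * pderivs (rev (i # v)) \<psi> x)"
    using Cons.IH[OF test_functions_partial[OF Cons.prems]] by (simp add: pderivs_append)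
  finally show ?case .
qed simp

text \<open>The contribution of one coordinate of the vector test function. Isolating it splits the
  vector functional into scalar ones that are represented separately.\<close>

definition adjoint_entry ::
  "(nat \<Rightarrow> 'n list \<Rightarrow> 'n list \<Rightarrow> real) \<Rightarrow> 'n list \<Rightarrow> (real ^ 'n \<Rightarrow> real) \<Rightarrow> real ^ 'n \<Rightarrow> real" where
  "adjoint_entry B w f x =
     (\<Sum>v | length v = length w. B (length w) w v * (- 1) ^ length v * pderivs (rev v) f x)"

definition explicit_adjoint ::
  "nat \<Rightarrow> (nat \<Rightarrow> 'n list \<Rightarrow> 'n list \<Rightarrow> real) \<Rightarrow> (real ^ 'n \<Rightarrow> 'n list \<Rightarrow> real) \<Rightarrow> real ^ 'n \<Rightarrow> real" where
  "explicit_adjoint d B \<phi> x = (\<Sum>w\<in>multi_indices d. adjoint_entry B w (\<lambda>x. \<phi> x w) x)"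

lemma adjoint_entry_test_functions:
  fixes f :: "real ^ 'n::finite \<Rightarrow> real"
  shows "f \<in> test_functions \<Longrightarrow> adjoint_entry B w f \<in> test_functions"
  unfolding adjoint_entry_def[abs_def]
  by (intro test_functions_sum finite_lists_eq_length test_functions_cmult test_functions_pderivs)

lemma explicit_adjoint_test_functions:
  fixes \<phi> :: "real ^ 'n::finite \<Rightarrow> 'n list \<Rightarrow> real"
  assumes "\<phi> \<in> vector_test_functions d"
  shows "explicit_adjoint d B \<phi> \<in> test_functions"
  unfolding explicit_adjoint_def[abs_def] using assms
  by (intro test_functions_sum finite_multi_indices adjoint_entry_test_functions)
     (auto simp: vector_test_functions_def)

lemma integral_explicit_adjoint:
  fixes u :: "real ^ 'n \<Rightarrow> real"
  assumes u: "smooth_on cube u" and \<phi>: "\<phi> \<in> vector_test_functions d"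
  shows "(LINT x:cube|lebesgue. u x * explicit_adjoint d B \<phi> x) =
    (LINT x:cube|lebesgue. (\<Sum>w\<in>multi_indices d. \<phi> x w * pde_op B u x w))"
proof -
  have t: "(\<lambda>x. \<phi> x w) \<in> test_functions" if "w \<in> multi_indices d" for w
    using \<phi> that by (auto simp: vector_test_functions_def)
  have uc: "continuous_on cube u" using smooth_on_continuous_pderivs[OF u, of "[]"] by simp
  have "(LINT x:cube|lebesgue. u x * explicit_adjoint d B \<phi> x) =
      (LINT x:cube|lebesgue. (\<Sum>w\<in>multi_indices d. \<Sum>v | length v = length w.
        (B (length w) w v * (- 1) ^ length v) * (u x * pderivs (rev v) (\<lambda>x. \<phi> x w) x)))"
    by (simp add: explicit_adjoint_def adjoint_entry_def sum_distrib_left mult_ac)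
  also have "\<dots> = (\<Sum>w\<in>multi_indices d. \<Sum>v | length v = length w.
        (B (length w) w v * (- 1) ^ length v) * (LINT x:cube|lebesgue. u x * pderivs (rev v) (\<lambda>x. \<phi> x w) x))"
    using uc t by (simp add: set_lebesgue_integral_sum set_integrable_sum set_integrable_mult_right
        set_integral_cutoff(1) test_functions_pderivs cong: sum.cong)
  also have "\<dots> = (\<Sum>w\<in>multi_indices d. \<Sum>v | length v = length w.
        B (length w) w v * (LINT x:cube|lebesgue. pderivs v u x * \<phi> x w))"
    by (intro sum.cong refl, subst pderivs_by_parts[OF u t]) auto
  also have "\<dots> = (LINT x:cube|lebesgue. (\<Sum>w\<in>multi_indices d. \<Sum>v | length v = length w.
        B (length w) w v * (pderivs v u x * \<phi> x w)))"
    using smooth_on_continuous_pderivs[OF u] t by (simp add: set_lebesgue_integral_sum set_integrable_sum set_integrable_mult_right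
        set_integral_cutoff(1) cong: sum.cong)
  also have "\<dots> = (LINT x:cube|lebesgue. (\<Sum>w\<in>multi_indices d. \<phi> x w * pde_op B u x w))"
    by (simp add: pde_op_def sum_distrib_left mult_ac)
  finally show ?thesis .
qed

text \<open>A vanishing integral of the square makes \<open>h\<close> zero almost everywhere. The
  set where \<open>h\<close> is nonzero is open, and a nonempty open set is not negligible.\<close>

lemma test_function_eq_0:
  fixes h :: "real ^ 'n \<Rightarrow> real"
  assumes h: "h \<in> test_functions" and 0: "(LINT x:cube|lebesgue. h x * h x) = 0"
  shows "h = (\<lambda>x. 0)"
proof -
  note c = test_functions_continuous[OF h, of cube]
  have eq: "(\<lambda>x. indicator cube x * (h x * h x)) = (\<lambda>x. h x * h x)"
    using test_functions_zero_outside[OF h] by (auto simp: fun_eq_iff indicator_def)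
  from 0 have "integral\<^sup>L lborel (\<lambda>x. h x * h x) = 0"
    by (simp add: set_integral_cutoff(3)[OF c h] eq)
  moreover have "integrable lborel (\<lambda>x. h x * h x)"
    using set_integral_cutoff(2)[OF c h] by (simp add: eq)
  ultimately have "AE x in lborel. h x * h x = 0"
    using integral_nonneg_eq_0_iff_AE[of lborel "\<lambda>x. h x * h x"] by simp
  then have "AE x in lborel. x \<notin> {x. h x \<noteq> 0}" by eventually_elim simp
  then have ae: "AE x in lebesgue. x \<notin> {x. h x \<noteq> 0}" by (rule AE_completion)
  have op: "open {x. h x \<noteq> 0}"
    using test_functions_continuous[OF h] by (intro open_Collect_neq continuous_on_const)
  then have "{x. h x \<noteq> 0} \<in> sets lebesgue" by (intro sets_completionI_sets) simp
  then have "negligible {x. h x \<noteq> 0}"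
    using ae by (simp only: negligible_iff_null_sets AE_iff_null_sets)
  with op show ?thesis using open_not_negligible by blast
qed

text \<open>Two candidates differ by a test function \<open>h\<close>, which is itself an admissible
  \<open>u\<close>. Pairing both candidates with \<open>h\<close> shows that the square of
  \<open>h\<close> has integral zero.\<close>

lemma formal_adjoint_eq:
  fixes \<phi> :: "real ^ 'n::finite \<Rightarrow> 'n list \<Rightarrow> real"
  assumes \<phi>: "\<phi> \<in> vector_test_functions d"
  shows "formal_adjoint d B \<phi> = explicit_adjoint d B \<phi>"
  unfolding formal_adjoint_def
proof (rule the_equality)
  show "explicit_adjoint d B \<phi> \<in> test_functions \<and> (\<forall>u. smooth_on cube u \<longrightarrow>
      (LINT x:cube|lebesgue. u x * explicit_adjoint d B \<phi> x) =
      (LINT x:cube|lebesgue. (\<Sum>w\<in>multi_indices d. \<phi> x w * pde_op B u x w)))"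
    using explicit_adjoint_test_functions[OF \<phi>] integral_explicit_adjoint[OF _ \<phi>] by blast
next
  fix g :: "real ^ 'n \<Rightarrow> real"
  assume g: "g \<in> test_functions \<and> (\<forall>u. smooth_on cube u \<longrightarrow> (LINT x:cube|lebesgue. u x * g x) =
      (LINT x:cube|lebesgue. (\<Sum>w\<in>multi_indices d. \<phi> x w * pde_op B u x w)))"
  define h where "h x = 1 * g x + (- 1) * explicit_adjoint d B \<phi> x" for x
  have h: "h \<in> test_functions" unfolding h_def[abs_def]
    using g by (intro test_functions_linear explicit_adjoint_test_functions \<phi>) auto
  note c = test_functions_continuous[OF h, of cube]
  have "(LINT x:cube|lebesgue. h x * h x) =
      (LINT x:cube|lebesgue. h x * g x) - (LINT x:cube|lebesgue. h x * explicit_adjoint d B \<phi> x)"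
    using set_integral_cutoff(1)[OF c conjunct1[OF g]] set_integral_cutoff(1)[OF c explicit_adjoint_test_functions[OF \<phi>, of B]]
    by (subst set_integral_diff(2)[symmetric]) (auto simp: h_def algebra_simps)
  also have "\<dots> = 0"
    using g integral_explicit_adjoint[OF test_functions_smooth_on[OF h] \<phi>] test_functions_smooth_on[OF h] by simp
  finally have "h = (\<lambda>x. 0)" by (rule test_function_eq_0[OF h])
  then show "g = explicit_adjoint d B \<phi>" by (auto simp: h_def fun_eq_iff)
qed

section \<open>Lower semicontinuity\<close>

lemma PV_lower_semicontinuous:
  fixes u :: "nat \<Rightarrow> real ^ 'n::finite \<Rightarrow> real"
  assumes "\<And>g. g \<in> test_functions \<Longrightarrow>
    (\<lambda>n. LINT x:cube|lebesgue. u n x * g x) \<longlonglongrightarrow> (LINT x:cube|lebesgue. v x * g x)"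
  shows "PV d B v \<le> liminf (\<lambda>n. PV d B (u n))"
  unfolding PV_def[of d B v]
proof (rule SUP_least)
  fix \<phi> :: "real ^ 'n \<Rightarrow> 'n list \<Rightarrow> real"
  assume \<phi>: "\<phi> \<in> {\<phi> \<in> vector_test_functions d. \<forall>x\<in>cube. L2_set (\<phi> x) (multi_indices d) \<le> 1}"
  have "formal_adjoint d B \<phi> \<in> test_functions"
    using \<phi> by (auto simp: formal_adjoint_eq intro: explicit_adjoint_test_functions)
  from assms[OF this] have "(\<lambda>n. ereal (LINT x:cube|lebesgue. u n x * formal_adjoint d B \<phi> x))
      \<longlonglongrightarrow> ereal (LINT x:cube|lebesgue. v x * formal_adjoint d B \<phi> x)"
    by simp
  then have "ereal (LINT x:cube|lebesgue. v x * formal_adjoint d B \<phi> x) =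
      liminf (\<lambda>n. ereal (LINT x:cube|lebesgue. u n x * formal_adjoint d B \<phi> x))"
    by (intro lim_imp_Liminf[symmetric]) simp_all
  also have "\<dots> \<le> liminf (\<lambda>n. PV d B (u n))"
    unfolding PV_def using \<phi> by (intro Liminf_mono always_eventually allI SUP_upper)
  finally show "ereal (LINT x:cube|lebesgue. v x * formal_adjoint d B \<phi> x) \<le> liminf (\<lambda>n. PV d B (u n))" .
qed

lemma test_functions_C0: "g \<in> test_functions \<Longrightarrow> g \<in> C0_cube"
proof -
  assume g: "g \<in> test_functions"
  obtain K where K: "compact K" "K \<subseteq> cube" "\<And>x. x \<notin> K \<Longrightarrow> g x = 0"
    using test_functionsE[OF g] by metis
  have "compact {x \<in> cube. e \<le> \<bar>g x\<bar>}" if "e > 0" for e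
  proof -
    have "closed {x. e \<le> \<bar>g x\<bar>}"
      by (intro closed_Collect_le continuous_intros test_functions_continuous g)
    moreover have "{x \<in> cube. e \<le> \<bar>g x\<bar>} = K \<inter> {x. e \<le> \<bar>g x\<bar>}"
      using K that by force
    ultimately show ?thesis using K(1) by (simp add: compact_Int_closed)
  qed
  then show ?thesis using g by (simp add: C0_cube_def test_functions_continuous)
qed

lemma integrable_mult_bounded:
  fixes f g :: "'a \<Rightarrow> real"
  assumes f: "integrable M f" and g: "g \<in> borel_measurable M" "\<And>x. \<bar>g x\<bar> \<le> G"
  shows "integrable M (\<lambda>x. f x * g x)"
proof (rule Bochner_Integration.integrable_bound[OF integrable_mult_right[OF f, of G]])
  show "(\<lambda>x. f x * g x) \<in> borel_measurable M"
    by (rule borel_measurable_times[OF borel_measurable_integrable[OF f] g(1)])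
  show "AE x in M. norm (f x * g x) \<le> norm (G * f x)"
  proof (rule AE_I2)
    fix x
    have "\<bar>g x\<bar> \<le> \<bar>G\<bar>" using g(2)[of x] by linarith
    then have "\<bar>f x\<bar> * \<bar>g x\<bar> \<le> \<bar>f x\<bar> * \<bar>G\<bar>" by (rule mult_left_mono) simp
    then show "norm (f x * g x) \<le> norm (G * f x)" by (simp add: abs_mult mult.commute)
  qed
qed

text \<open>A Vitali argument on the compact set \<open>K\<close> that carries \<open>g\<close>,
  split along the set \<open>E n\<close> where \<open>U n\<close> and \<open>V\<close> are far
  apart. Off \<open>E n\<close>, dominated convergence applies with bound
  \<open>indicator K\<close>. On \<open>E n\<close>, whose indicators tend to 0 almost everywhere,
  uniform integrability handles \<open>U n\<close> and dominated convergence handles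
  \<open>V\<close>.\<close>

lemma locally_uniformly_integrable_imp_converges:
  fixes u :: "nat \<Rightarrow> real ^ 'n::finite \<Rightarrow> real"
  assumes u: "\<And>n. u n \<in> L1_cube" and v: "v \<in> L1_cube"
    and ui: "locally_uniformly_integrable u"
    and ae: "AE x in lebesgue. x \<in> cube \<longrightarrow> (\<lambda>n. u n x) \<longlonglongrightarrow> v x"
    and g: "g \<in> test_functions"
  shows "(\<lambda>n. LINT x:cube|lebesgue. u n x * g x) \<longlonglongrightarrow> (LINT x:cube|lebesgue. v x * g x)"
proof -
  obtain K where K: "compact K" "K \<subseteq> cube" "\<And>x. x \<notin> K \<Longrightarrow> g x = 0"
    using test_functionsE[OF g] by metis
  have gc: "continuous_on UNIV g" by (rule test_functions_continuous[OF g])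
  obtain G where G: "\<And>x. \<bar>g x\<bar> \<le> G" "G > 0"
    using bounded_compact_support[OF gc K(1) K(3)] by blast
  have gm[measurable]: "g \<in> borel_measurable lebesgue"
    using borel_measurable_continuous_onI[OF gc] by (simp add: measurable_completion)
  have Km[measurable]: "K \<in> sets lebesgue" using K(1) by (simp add: lmeasurable_compact fmeasurableD)
  have fK: "emeasure lebesgue K < \<infinity>" using lmeasurable_compact[OF K(1)] by (simp add: fmeasurable_def)
  define U where "U n x = indicator K x * u n x" for n x
  define V where "V x = indicator K x * v x" for x
  have iK: "integrable lebesgue (\<lambda>x. indicator K x * f x)" if "f \<in> L1_cube" for f :: "real ^ 'n \<Rightarrow> real"
  proof -
    have "set_integrable lebesgue cube f" using that by (simp add: L1_cube_def)
    then have "set_integrable lebesgue K f" by (rule set_integrable_subset[OF _ Km K(2)])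
    then show ?thesis by (simp add: set_integrable_def)
  qed
  have iU: "integrable lebesgue (U n)" for n using iK[OF u] by (simp add: U_def[abs_def])
  have iV: "integrable lebesgue V" using iK[OF v] by (simp add: V_def[abs_def])
  note [measurable] = borel_measurable_integrable[OF iU] borel_measurable_integrable[OF iV]
  have conv: "AE x in lebesgue. (\<lambda>n. U n x) \<longlonglongrightarrow> V x"
    using ae by eventually_elim (use K(2) in \<open>auto simp: U_def V_def indicator_def\<close>)
  \<comment> \<open>The threshold 1 is arbitrary: any positive level bounds the difference off
    \<open>E n\<close>.\<close>
  define E where "E n = {x. 1 < \<bar>U n x - V x\<bar>}" for n
  have Em[measurable]: "E n \<in> sets lebesgue" for n
  proof -
    have "{x \<in> space lebesgue. 1 < \<bar>U n x - V x\<bar>} \<in> sets lebesgue" by measurable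
    then show ?thesis by (simp add: E_def)
  qed
  have EK: "E n \<subseteq> K" for n by (auto simp: E_def U_def V_def indicator_def split: if_splits)
  have far: "AE x in lebesgue. \<forall>\<^sub>F n in sequentially. x \<notin> E n"
    using conv
  proof eventually_elim
    case (elim x)
    then have "(\<lambda>n. \<bar>U n x - V x\<bar>) \<longlonglongrightarrow> \<bar>V x - V x\<bar>" by (intro tendsto_intros)
    then have "\<forall>\<^sub>F n in sequentially. \<bar>U n x - V x\<bar> < 1" by (intro order_tendstoD(2)) auto
    then show ?case by eventually_elim (auto simp: E_def)
  qed
  have far0: "AE x in lebesgue. (\<lambda>n. indicator (E n) x * f x) \<longlonglongrightarrow> 0" for f :: "real ^ 'n \<Rightarrow> real"
    using far
  proof eventually_elim
    case (elim x)
    then have "\<forall>\<^sub>F n in sequentially. indicator (E n) x * f x = 0" by eventually_elim auto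
    then show ?case by (rule tendsto_eventually)
  qed
  have intE: "(\<lambda>n. LINT x|lebesgue. indicator (E n) x * f x) \<longlonglongrightarrow> 0"
    if f: "integrable lebesgue f" "\<And>x. f x \<ge> 0" for f :: "real ^ 'n \<Rightarrow> real"
  proof -
    note [measurable] = borel_measurable_integrable[OF f(1)]
    \<comment> \<open>The factor \<open>g x\<close> is a dummy: the limit function is zero.\<close>
    have "(\<lambda>n. LINT x|lebesgue. indicator (E n) x * f x) \<longlonglongrightarrow> (LINT x|lebesgue. 0 * g x)"
    proof (rule integral_dominated_convergence[where w = f])
      show "AE x in lebesgue. norm (indicator (E n) x * f x) \<le> f x" for n
        using f(2) by (auto intro!: AE_I2 simp: indicator_def)
    qed (use f(1) far0 in auto)
    then show ?thesis by simp
  qed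
  have one: "integrable lebesgue (indicator K :: _ \<Rightarrow> real)"
    using fK Km by (simp add: integrable_indicator_iff)
  have mE: "(\<lambda>n. measure lebesgue (E n)) \<longlonglongrightarrow> 0"
  proof -
    have "indicator (E n) x * indicator K x = (indicator (E n) x :: real)" for n x
      using EK[of n] by (auto simp: indicator_def)
    with intE[OF one] show ?thesis by simp
  qed
  have c: "(\<lambda>n. LINT x|lebesgue. indicator (E n) x * \<bar>U n x\<bar>) \<longlonglongrightarrow> 0"
  proof (rule LIMSEQ_I)
    fix r :: real assume "r > 0"
    then obtain \<delta> where \<delta>: "\<delta> > 0" "\<And>n F. F \<in> sets lebesgue \<Longrightarrow> F \<subseteq> K \<Longrightarrow> measure lebesgue F < \<delta> \<Longrightarrow>
        (LINT x:F|lebesgue. \<bar>u n x\<bar>) < r"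
      using ui K(1,2) unfolding locally_uniformly_integrable_def uniformly_integrable_on_def by metis
    from LIMSEQ_D[OF mE \<delta>(1)] obtain m where m: "\<And>n. n \<ge> m \<Longrightarrow> measure lebesgue (E n) < \<delta>" by auto
    show "\<exists>m. \<forall>n\<ge>m. norm ((LINT x|lebesgue. indicator (E n) x * \<bar>U n x\<bar>) - 0) < r"
    proof (intro exI[of _ m] allI impI)
      fix n assume "n \<ge> m"
      have "(LINT x|lebesgue. indicator (E n) x * \<bar>U n x\<bar>) = (LINT x:E n|lebesgue. \<bar>u n x\<bar>)"
        unfolding set_lebesgue_integral_def using EK[of n]
        by (intro Bochner_Integration.integral_cong) (auto simp: U_def indicator_def)
      also have "\<dots> < r" using \<delta>(2)[OF Em EK m[OF \<open>n \<ge> m\<close>]] .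
      finally show "norm ((LINT x|lebesgue. indicator (E n) x * \<bar>U n x\<bar>) - 0) < r"
        using Bochner_Integration.integral_nonneg[of lebesgue "\<lambda>x. indicator (E n) x * \<bar>U n x\<bar>"] by simp
    qed
  qed
  have b: "(\<lambda>n. LINT x|lebesgue. indicator (E n) x * \<bar>V x\<bar>) \<longlonglongrightarrow> 0"
    by (rule intE) (use iV in auto)
  have a: "(\<lambda>n. LINT x|lebesgue. indicator (- E n) x * \<bar>U n x - V x\<bar>) \<longlonglongrightarrow> 0"
  proof -
    have "(\<lambda>n. LINT x|lebesgue. indicator (- E n) x * \<bar>U n x - V x\<bar>) \<longlonglongrightarrow> (LINT x|lebesgue. 0 * g x)"
    proof (rule integral_dominated_convergence[OF _ _ one])
      show "AE x in lebesgue. (\<lambda>n. indicator (- E n) x * \<bar>U n x - V x\<bar>) \<longlonglongrightarrow> 0 * g x"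
        using conv
      proof eventually_elim
        case (elim x)
        then have z: "(\<lambda>n. \<bar>U n x - V x\<bar>) \<longlonglongrightarrow> 0" by (intro tendsto_rabs_zero LIM_zero)
        have "norm (indicator (- E n) x * \<bar>U n x - V x\<bar>) \<le> \<bar>U n x - V x\<bar>" for n
          by (simp add: indicator_def)
        then show ?case unfolding mult_zero_left by (intro Lim_null_comparison[OF _ z] always_eventually allI)
      qed
      show "AE x in lebesgue. norm (indicator (- E n) x * \<bar>U n x - V x\<bar>) \<le> indicator K x" for n
        by (rule AE_I2) (auto simp: indicator_def E_def U_def V_def)
      show "(\<lambda>x. 0 * g x) \<in> borel_measurable lebesgue" by simp
      have Cm[measurable]: "- E n \<in> sets lebesgue" for n
        using sets.compl_sets[OF Em, of n] by (simp add: Compl_eq_Diff_UNIV)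
      show "(\<lambda>x. indicator (- E n) x * \<bar>U n x - V x\<bar>) \<in> borel_measurable lebesgue" for n
        by measurable
    qed
    then show ?thesis by simp
  qed
  have "(\<lambda>n. G * ((LINT x|lebesgue. indicator (- E n) x * \<bar>U n x - V x\<bar>) +
      (LINT x|lebesgue. indicator (E n) x * \<bar>U n x\<bar>) + (LINT x|lebesgue. indicator (E n) x * \<bar>V x\<bar>))) \<longlonglongrightarrow> G * (0 + 0 + 0)"
    by (intro tendsto_intros a b c)
  then have lim: "(\<lambda>n. G * ((LINT x|lebesgue. indicator (- E n) x * \<bar>U n x - V x\<bar>) +
      (LINT x|lebesgue. indicator (E n) x * \<bar>U n x\<bar>) + (LINT x|lebesgue. indicator (E n) x * \<bar>V x\<bar>))) \<longlonglongrightarrow> 0"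
    by simp
  have restrict: "(LINT x:cube|lebesgue. f x * g x) = (LINT x|lebesgue. indicator K x * f x * g x)"
    for f :: "real ^ 'n \<Rightarrow> real"
    unfolding set_lebesgue_integral_def using K(2,3)
    by (intro Bochner_Integration.integral_cong) (auto simp: indicator_def)
  have ig: "integrable lebesgue (\<lambda>x. f x * g x)" if "integrable lebesgue f" for f :: "real ^ 'n \<Rightarrow> real"
    using that gm G(1) by (rule integrable_mult_bounded)
  have "(\<lambda>n. (LINT x|lebesgue. U n x * g x) - (LINT x|lebesgue. V x * g x)) \<longlonglongrightarrow> 0"
  proof (rule Lim_null_comparison[OF always_eventually lim], intro allI)
    fix n
    have i1: "integrable lebesgue (\<lambda>x. indicator (- E n) x * \<bar>U n x - V x\<bar>)"
      "integrable lebesgue (\<lambda>x. indicator (E n) x * \<bar>U n x\<bar>)"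
      "integrable lebesgue (\<lambda>x. indicator (E n) x * \<bar>V x\<bar>)"
      using integrable_mult_indicator[of "- E n" lebesgue "\<lambda>x. \<bar>U n x - V x\<bar>"]
        integrable_mult_indicator[of "E n" lebesgue "\<lambda>x. \<bar>U n x\<bar>"]
        integrable_mult_indicator[of "E n" lebesgue "\<lambda>x. \<bar>V x\<bar>"] iU iV Em
      by (auto intro!: sets.compl_sets simp: Compl_eq_Diff_UNIV sets.Diff)
    have "norm ((LINT x|lebesgue. U n x * g x) - (LINT x|lebesgue. V x * g x)) =
        norm (LINT x|lebesgue. U n x * g x - V x * g x)"
      using ig[OF iU] ig[OF iV] by simp
    also have "\<dots> \<le> (LINT x|lebesgue. G * (indicator (- E n) x * \<bar>U n x - V x\<bar> + indicator (E n) x * \<bar>U n x\<bar>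
        + indicator (E n) x * \<bar>V x\<bar>))"
    proof (rule Bochner_Integration.integral_norm_bound_integral)
      fix x
      have "norm (U n x * g x - V x * g x) = \<bar>U n x - V x\<bar> * \<bar>g x\<bar>"
        by (simp add: left_diff_distrib[symmetric] abs_mult)
      also have "\<dots> \<le> \<bar>U n x - V x\<bar> * G" by (intro mult_left_mono G) auto
      \<comment> \<open>Off \<open>E n\<close> the first term is the difference itself; on
        \<open>E n\<close> the triangle inequality applies.\<close>
      also have "\<dots> \<le> (indicator (- E n) x * \<bar>U n x - V x\<bar> + indicator (E n) x * \<bar>U n x\<bar>
        + indicator (E n) x * \<bar>V x\<bar>) * G"
        using G(2) by (intro mult_right_mono) (auto simp: indicator_def)
      finally show "norm (U n x * g x - V x * g x) \<le> G * (indicator (- E n) x * \<bar>U n x - V x\<bar> + indicator (E n) x * \<bar>U n x\<bar>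
        + indicator (E n) x * \<bar>V x\<bar>)" by (simp only: mult.commute)
    qed (use ig[OF iU] ig[OF iV] i1 in auto)
    also have "\<dots> = G * ((LINT x|lebesgue. indicator (- E n) x * \<bar>U n x - V x\<bar>) +
      (LINT x|lebesgue. indicator (E n) x * \<bar>U n x\<bar>) + (LINT x|lebesgue. indicator (E n) x * \<bar>V x\<bar>))"
      using i1 by simp
    finally show "norm ((LINT x|lebesgue. U n x * g x) - (LINT x|lebesgue. V x * g x)) \<le>
      G * ((LINT x|lebesgue. indicator (- E n) x * \<bar>U n x - V x\<bar>) +
      (LINT x|lebesgue. indicator (E n) x * \<bar>U n x\<bar>) + (LINT x|lebesgue. indicator (E n) x * \<bar>V x\<bar>))" .
  qed
  then show ?thesis
    unfolding restrict by (simp add: LIM_zero_iff U_def V_def)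
qed

section \<open>Weak compactness of discrete measures\<close>

text \<open>A 2-periodic function that is 0 on [0, 1/3] and 1 on [2/3, 1]. The clamped cosine has
  these plateaus because cos (pi/3) = 1/2.\<close>

definition peano_wave :: "real \<Rightarrow> real" where
  "peano_wave t = max 0 (min 1 (1 / 2 - cos (pi * t)))"

lemma peano_wave_bounds: "0 \<le> peano_wave t" "peano_wave t \<le> 1"
  by (auto simp: peano_wave_def)

lemma continuous_on_peano_wave: "continuous_on A peano_wave"
  unfolding peano_wave_def by (intro continuous_intros)

text \<open>The argument is an even integer, a leading ternary digit \<open>2 * b\<close> that is 0
  or 2, and a tail \<open>r\<close>. The period removes the integer and the tail stays on the
  plateau selected by the digit, so the digit is read off exactly.\<close>

lemma peano_wave_digit:
  assumes "b = 0 \<or> b = 1" "0 \<le> r" "r \<le> 1 / 3"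
  shows "peano_wave (2 * of_int k + 2 * b / 3 + r) = b"
proof -
  have "cos (pi * (2 * of_int k + 2 * b / 3 + r)) = cos (pi * (2 * b / 3 + r))"
  proof -
    have "pi * (2 * of_int k + 2 * b / 3 + r) = pi * (2 * b / 3 + r) + of_int (2 * k) * pi"
      by (simp add: algebra_simps)
    moreover have "cos (of_int (2 * k) * pi) = 1" "sin (of_int (2 * k) * pi) = 0"
      using cos_int_2pin[of k] sin_int_2pin[of k] by (simp_all add: mult.commute mult.left_commute)
    ultimately show ?thesis by (simp only: cos_add)
  qed
  moreover have "cos (pi * r) \<ge> 1 / 2"
  proof -
    have "pi * r \<le> pi / 3" using mult_left_mono[OF assms(3), of pi] by simp
    then have "cos (pi / 3) \<le> cos (pi * r)"
      using assms by (intro cos_monotone_0_pi_le) auto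
    then show ?thesis by (simp add: cos_60)
  qed
  moreover have "cos (pi * (2 / 3 + r)) \<le> - 1 / 2"
  proof -
    have "pi * (2 / 3 + r) = pi - pi * (1 / 3 - r)" by (simp add: algebra_simps)
    then have "cos (pi * (2 / 3 + r)) = - cos (pi * (1 / 3 - r))" by simp
    moreover have "pi * (1 / 3 - r) \<le> pi / 3" using assms by (simp add: algebra_simps)
    then have "cos (pi / 3) \<le> cos (pi * (1 / 3 - r))"
      using assms by (intro cos_monotone_0_pi_le) auto
    ultimately show ?thesis by (simp add: cos_60)
  qed
  ultimately show ?thesis using assms(1) by (auto simp: peano_wave_def)
qed

text \<open>Schoenberg's space-filling curve: the waves read off the ternary digits of \<open>t\<close>, which are
  dealt out in turn as the binary digits of the \<open>N\<close> coordinates.\<close>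

definition peano :: "nat \<Rightarrow> nat \<Rightarrow> real \<Rightarrow> real" where
  "peano N j t = (\<Sum>m. (1 / 2) ^ Suc m * peano_wave (3 ^ (N * m + j) * t))"

lemma peano_term_bound: "norm ((1 / 2) ^ Suc m * peano_wave s) \<le> (1 / 2) ^ Suc m"
  using peano_wave_bounds[of s] by (simp add: abs_mult mult_left_le)

lemma summable_half_Suc: "summable (\<lambda>m. (1 / 2 :: real) ^ Suc m)"
  by (intro summable_mult summable_geometric[THEN summable_Suc_iff[THEN iffD2]]) auto

lemma peano_bounds: "0 \<le> peano N j t" "peano N j t \<le> 1"
proof -
  have s: "summable (\<lambda>m. (1 / 2) ^ Suc m * peano_wave (3 ^ (N * m + j) * t))"
    by (rule summable_comparison_test'[OF summable_half_Suc, of 0]) (rule peano_term_bound)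
  show "0 \<le> peano N j t" unfolding peano_def
    using peano_wave_bounds by (intro suminf_nonneg s) auto
  have "peano N j t \<le> (\<Sum>m. (1 / 2 :: real) ^ Suc m)" unfolding peano_def
    using peano_wave_bounds by (intro suminf_le s summable_half_Suc mult_left_le) auto
  also have "\<dots> = 1" using power_half_series by (rule sums_unique[symmetric])
  finally show "peano N j t \<le> 1" .
qed

lemma continuous_on_peano: "continuous_on UNIV (peano N j)"
  unfolding peano_def
proof (rule uniform_limit_theorem[OF _ Weierstrass_m_test])
  show "\<forall>\<^sub>F n in sequentially. continuous_on UNIV
      (\<lambda>t. \<Sum>m<n. (1 / 2) ^ Suc m * peano_wave (3 ^ (N * m + j) * t))"
    by (intro always_eventually allI continuous_intros
        continuous_on_compose2[OF continuous_on_peano_wave[of UNIV]]) auto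
  show "norm ((1 / 2) ^ Suc m * peano_wave (3 ^ (N * m + j) * t)) \<le> (1 / 2) ^ Suc m" for m t
    by (rule peano_term_bound)
qed (use summable_half_Suc in auto)

text \<open>Greedy doubling: after \<open>n\<close> digits the error is
  \<open>(1/2)^n * r n\<close>. The remainder ranges over the closed interval [0, 1], so
  \<open>x = 1\<close> is covered, with all digits 1.\<close>

lemma binary_expansion:
  assumes "0 \<le> x" "x \<le> (1::real)"
  obtains b :: "nat \<Rightarrow> real" where "\<And>m. b m = 0 \<or> b m = 1" "(\<lambda>m. (1 / 2) ^ Suc m * b m) sums x"
proof -
  define r where "r = rec_nat x (\<lambda>m y. if y \<ge> 1 / 2 then 2 * y - 1 else 2 * y)"
  have r0: "r 0 = x" and rS: "r (Suc m) = (if r m \<ge> 1 / 2 then 2 * r m - 1 else 2 * r m)" for m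
    by (simp_all add: r_def)
  define b where "b m = (if r m \<ge> 1 / 2 then 1 else 0 :: real)" for m
  have rb: "0 \<le> r m \<and> r m \<le> 1" for m
    by (induction m) (use assms in \<open>auto simp: r0 rS\<close>)
  have "(\<Sum>m<n. (1 / 2) ^ Suc m * b m) = x - (1 / 2) ^ n * r n" for n
    by (induction n) (auto simp: r0 rS b_def field_simps)
  moreover have "(\<lambda>n. x - (1 / 2) ^ n * r n) \<longlonglongrightarrow> x - 0"
  proof (intro tendsto_diff tendsto_const)
    show "(\<lambda>n. (1 / 2) ^ n * r n) \<longlonglongrightarrow> 0"
      by (rule Lim_null_comparison[OF _ LIMSEQ_realpow_zero[of "1 / 2 :: real"]])
         (use rb in \<open>auto simp: abs_mult mult_left_le\<close>)
  qed
  ultimately have "(\<lambda>m. (1 / 2) ^ Suc m * b m) sums x"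
    by (simp add: sums_def)
  then show ?thesis by (intro that[of b]) (auto simp: b_def)
qed

text \<open>The preimage is a point of the Cantor set: its ternary digits are doubled binary digits
  of the coordinates, so multiplication by a power of 3 always lands on a plateau of the
  wave.\<close>

lemma peano_surj:
  assumes "\<And>j. j < N \<Longrightarrow> 0 \<le> x j \<and> x j \<le> (1::real)" "N > 0"
  obtains t where "0 \<le> t" "t \<le> 1" "\<And>j. j < N \<Longrightarrow> peano N j t = x j"
proof -
  have "\<exists>b :: nat \<Rightarrow> real. (\<forall>m. b m = 0 \<or> b m = 1) \<and> (\<lambda>m. (1 / 2) ^ Suc m * b m) sums x j" if "j < N" for j
    using binary_expansion assms(1)[OF that] by metis
  then obtain b :: "nat \<Rightarrow> nat \<Rightarrow> real" where b: "\<And>j m. j < N \<Longrightarrow> b j m = 0 \<or> b j m = 1"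
    "\<And>j. j < N \<Longrightarrow> (\<lambda>m. (1 / 2) ^ Suc m * b j m) sums x j"
    by metis
  \<comment> \<open>Digit \<open>m\<close> of coordinate \<open>j\<close> goes to ternary position
    \<open>N * m + j\<close>, matching the frequencies in \<open>peano\<close>.\<close>
  define a where "a l = b (l mod N) (l div N)" for l
  have a01: "a l = 0 \<or> a l = 1" for l
    using b(1) assms(2) by (simp add: a_def)
  define T where "T = (\<lambda>l. 2 * a l / 3 ^ Suc l)"
  have geo: "(\<lambda>i. 2 / 3 ^ Suc i) sums (1 :: real)"
    using geometric_sums[of "1 / 3 :: real", THEN sums_mult, of "2 / 3"] by (simp add: power_divide)
  have sT: "summable (\<lambda>i. T (i + l))" for l
  proof -
    have "norm (T n) \<le> 2 / 3 ^ Suc n" for n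
      using a01[of n] by (auto simp: T_def)
    then have "summable T"
      by (rule summable_comparison_test'[OF sums_summable[OF geo], of 0])
    then show ?thesis by (simp add: summable_iff_shift)
  qed
  define t where "t = suminf T"
  have tail: "0 \<le> (\<Sum>i. T (i + l))" "(\<Sum>i. T (i + l)) \<le> 1 / 3 ^ l" for l
  proof -
    have T0: "0 \<le> T i" for i using a01[of i] by (auto simp: T_def)
    then show "0 \<le> (\<Sum>i. T (i + l))" by (intro suminf_nonneg sT) auto
    have g: "(\<lambda>i. (1 / 3 ^ l) * (2 / 3 ^ Suc i)) sums ((1 / 3 ^ l) * (1 :: real))"
      by (rule sums_mult[OF geo])
    have "(\<Sum>i. T (i + l)) \<le> (\<Sum>i. (1 / 3 ^ l) * (2 / 3 ^ Suc i))"
    proof (intro suminf_le sT sums_summable[OF g])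
      fix i show "T (i + l) \<le> (1 / 3 ^ l) * (2 / 3 ^ Suc i)"
        using a01[of "i + l"] by (auto simp: T_def power_add mult_ac)
    qed
    then show "(\<Sum>i. T (i + l)) \<le> 1 / 3 ^ l" using sums_unique[OF g] by simp
  qed
  have digit: "peano_wave (3 ^ l * t) = a l" for l
  proof -
    \<comment> \<open>All digits in front of position \<open>l\<close> are even, so they add up to
      an even integer, a period of the wave: \<open>3 * (2 * k) + 2 * a l\<close> is again even,
      with \<open>3 * k\<close> or \<open>3 * k + 1\<close> as its half.\<close>
    have "\<exists>k. 3 ^ l * (\<Sum>i<l. T i) = 2 * of_int k"
    proof (induction l)
      case (Suc l)
      then obtain k where k: "3 ^ l * (\<Sum>i<l. T i) = 2 * of_int k" by auto
      have "3 ^ Suc l * (\<Sum>i<Suc l. T i) = 3 * (3 ^ l * (\<Sum>i<l. T i)) + 2 * a l"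
        by (simp add: T_def algebra_simps)
      with k a01[of l] show ?case
        by (auto intro: exI[of _ "3 * k"] exI[of _ "3 * k + 1"])
    qed auto
    then obtain k where k: "3 ^ l * (\<Sum>i<l. T i) = 2 * of_int k" by auto
    have "t = (\<Sum>i. T (i + Suc l)) + (\<Sum>i<Suc l. T i)"
      unfolding t_def using suminf_split_initial_segment[of T "Suc l"] sT[of 0] by simp
    then have "3 ^ l * t = 3 ^ l * (\<Sum>i<l. T i) + 3 ^ l * T l + 3 ^ l * (\<Sum>i. T (i + Suc l))"
      by (simp add: algebra_simps)
    also have "3 ^ l * T l = 2 * a l / 3" by (simp add: T_def)
    finally have eq: "3 ^ l * t = 2 * of_int k + 2 * a l / 3 + 3 ^ l * (\<Sum>i. T (i + Suc l))" using k by simp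
    have "3 ^ l * (\<Sum>i. T (i + Suc l)) \<le> 3 ^ l * (1 / 3 ^ Suc l)"
      by (intro mult_left_mono tail) auto
    then show ?thesis unfolding eq
      using tail(1)[of "Suc l"] by (intro peano_wave_digit a01) auto
  qed
  show ?thesis
  proof
    show "0 \<le> t" "t \<le> 1" using tail[of 0] by (simp_all add: t_def)
    fix j assume j: "j < N"
    have "peano N j t = (\<Sum>m. (1 / 2) ^ Suc m * b j m)"
      unfolding peano_def digit using j by (simp add: a_def)
    then show "peano N j t = x j" using sums_unique[OF b(2)[OF j]] by simp
  qed
qed

lemma peano_cube:
  obtains P :: "real \<Rightarrow> real ^ 'n::finite" where
    "continuous_on UNIV P" "\<And>t i. 0 \<le> P t $ i \<and> P t $ i \<le> 1"
    "\<And>x. (\<And>i. 0 \<le> x $ i \<and> x $ i \<le> 1) \<Longrightarrow> \<exists>t\<in>{0..1}. P t = x"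
proof -
  obtain e :: "'n \<Rightarrow> nat" where e: "bij_betw e UNIV {..<CARD('n)}"
    using ex_bij_betw_finite_nat[OF finite, of "UNIV :: 'n set"] unfolding atLeast0LessThan by blast
  have e_lt: "e i < CARD('n)" for i using e by (auto simp: bij_betw_def)
  show ?thesis
  proof (rule that[of "\<lambda>t. \<chi> i. peano CARD('n) (e i) t"])
    show "continuous_on UNIV (\<lambda>t. \<chi> i. peano CARD('n) (e i) t)"
      by (intro continuous_on_vec_lambda continuous_on_peano)
    fix x :: "real ^ 'n" assume x: "\<And>i. 0 \<le> x $ i \<and> x $ i \<le> 1"
    obtain t where t: "0 \<le> t" "t \<le> 1"
      "\<And>j. j < CARD('n) \<Longrightarrow> peano CARD('n) j t = x $ the_inv_into UNIV e j"
      by (rule peano_surj[of "CARD('n)" "\<lambda>j. x $ the_inv_into UNIV e j"]) (use x in auto)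
    have "peano CARD('n) (e i) t = x $ i" for i
      using t(3)[OF e_lt[of i]] e by (simp add: the_inv_into_f_f bij_betw_def)
    with t(1,2) show "\<exists>t\<in>{0..1}. (\<chi> i. peano CARD('n) (e i) t) = x"
      by (intro bexI[of _ t]) (auto simp: vec_eq_iff)
  qed (use peano_bounds in auto)
qed

text \<open>The weights are lifted along the curve to \<open>[0, 1]\<close>, where Helly's selection theorem applies;
  the limit is pushed forward to the cube. The lifting need not be continuous.\<close>

lemma discrete_measures_compact:
  fixes x :: "nat \<Rightarrow> 'k \<Rightarrow> real ^ 'n::finite" and w :: "nat \<Rightarrow> 'k \<Rightarrow> real"
  assumes A: "\<And>n. finite (A n)" and w0: "\<And>n a. a \<in> A n \<Longrightarrow> 0 \<le> w n a"
    and w1: "\<And>n. (\<Sum>a\<in>A n. w n a) = 1"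
    and x: "\<And>n a i. a \<in> A n \<Longrightarrow> 0 \<le> x n a $ i \<and> x n a $ i \<le> 1"
  obtains r \<nu> where "strict_mono r" "prob_space \<nu>" "sets \<nu> = sets borel"
    "\<And>f :: real ^ 'n \<Rightarrow> real. continuous_on UNIV f \<Longrightarrow>
      (\<lambda>n. \<Sum>a\<in>A (r n). w (r n) a * f (x (r n) a)) \<longlonglongrightarrow> integral\<^sup>L \<nu> f"
proof -
  obtain P :: "real \<Rightarrow> real ^ 'n" where P: "continuous_on UNIV P" "\<And>t i. 0 \<le> P t $ i \<and> P t $ i \<le> 1"
    "\<And>x. (\<And>i. 0 \<le> x $ i \<and> x $ i \<le> 1) \<Longrightarrow> \<exists>t\<in>{0..1}. P t = x"
    using peano_cube by blast
  define T where "T n a = (SOME t. t \<in> {0..1} \<and> P t = x n a)" for n a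
  have T: "T n a \<in> {0..1} \<and> P (T n a) = x n a" if "a \<in> A n" for n a
  proof -
    have "\<exists>t. t \<in> {0..1} \<and> P t = x n a" using P(3)[of "x n a", OF x[OF that]] by auto
    from someI_ex[OF this] show ?thesis by (simp only: T_def)
  qed
  define \<mu> where "\<mu> n = distr (point_measure (A n) (\<lambda>a. ennreal (w n a))) borel (T n)" for n
  have prob: "prob_space (point_measure (A n) (\<lambda>a. ennreal (w n a)))" for n
    by standard (use A w0 w1 in \<open>simp add: space_point_measure emeasure_point_measure_finite sum_ennreal\<close>)
  have rd: "real_distribution (\<mu> n)" for n
    unfolding \<mu>_def real_distribution_def real_distribution_axioms_def
    by (auto intro!: prob_space.prob_space_distr prob)
  have int: "integral\<^sup>L (\<mu> n) g = (\<Sum>a\<in>A n. w n a * g (T n a))" if "g \<in> borel_measurable borel" for g :: "real \<Rightarrow> real" and n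
    unfolding \<mu>_def using A w0 that
    by (subst integral_distr) (auto simp: lebesgue_integral_point_measure_finite)
  have tight: "tight \<mu>"
    unfolding tight_def
  proof (intro conjI allI impI rd)
    fix e :: real assume "e > 0"
    \<comment> \<open>The lifted atoms lie in [0, 1]; any half-open interval around it carries the
      full mass for all \<open>n\<close> at once.\<close>
    have "measure (\<mu> n) {- 1<..2} = 1" for n
    proof -
      have "T n a \<in> {- 1<..2}" if "a \<in> A n" for a using T[OF that] by auto
      then have "(T n -` {- 1<..2}) \<inter> A n = A n" by blast
      then show ?thesis unfolding \<mu>_def using prob_space.prob_space[OF prob]
        by (subst measure_distr) (auto simp: space_point_measure)
    qed
    with \<open>e > 0\<close> show "\<exists>a b. a < b \<and> (\<forall>n. measure (\<mu> n) {a<..b} > 1 - e)"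
      by (intro exI[of _ "-1"] exI[of _ "2"]) auto
  qed
  from tight_imp_convergent_subsubsequence[OF tight strict_mono_id]
  obtain r M where r: "strict_mono r" and M: "real_distribution M" and conv: "weak_conv_m (\<mu> \<circ> id \<circ> r) M"
    by blast
  interpret M: real_distribution M by (rule M)
  have Pm: "P \<in> borel_measurable borel" using P(1) by (rule borel_measurable_continuous_onI)
  show ?thesis
  proof (rule that[OF r, of "distr M borel P"])
    show "prob_space (distr M borel P)" using Pm by (intro M.prob_space_distr) simp
    fix f :: "real ^ 'n \<Rightarrow> real" assume f: "continuous_on UNIV f"
    have fm: "f \<in> borel_measurable borel" using f by (rule borel_measurable_continuous_onI)
    have c: "continuous_on UNIV (\<lambda>t. f (P t))" using continuous_on_compose2[OF f P(1)] by simp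
    \<comment> \<open>\<open>f\<close> may be unbounded on the whole space, but the curve stays in
      the closed cube, so its composition with \<open>P\<close> is a bounded continuous test for
      weak convergence.\<close>
    have "compact (f ` cbox 0 1)"
      by (intro compact_continuous_image continuous_on_subset[OF f]) auto
    then have "bounded (f ` cbox 0 1)" by (rule compact_imp_bounded)
    then obtain K where K: "\<And>y. y \<in> cbox 0 1 \<Longrightarrow> norm (f y) \<le> K"
      unfolding bounded_iff by blast
    have "P t \<in> cbox 0 1" for t using P(2) by (simp add: mem_box_cart)
    with K have K': "norm (f (P t)) \<le> K" for t by blast
    have "(\<lambda>n. integral\<^sup>L ((\<mu> \<circ> id \<circ> r) n) (\<lambda>t. f (P t))) \<longlonglongrightarrow> integral\<^sup>L M (\<lambda>t. f (P t))"
    proof (rule weak_conv_imp_integral_bdd_continuous_conv[OF _ M conv, where B = K])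
      show "real_distribution ((\<mu> \<circ> id \<circ> r) n)" for n using rd by simp
      show "isCont (\<lambda>t. f (P t)) t" for t using c by (simp add: continuous_on_eq_continuous_at)
    qed (rule K')
    moreover have "integral\<^sup>L ((\<mu> \<circ> id \<circ> r) n) (\<lambda>t. f (P t)) = (\<Sum>a\<in>A (r n). w (r n) a * f (x (r n) a))" for n
      using int[of "\<lambda>t. f (P t)" "r n"] c T by (auto simp: borel_measurable_continuous_onI intro!: sum.cong)
    moreover have "integral\<^sup>L M (\<lambda>t. f (P t)) = integral\<^sup>L (distr M borel P) f"
      using Pm fm by (subst integral_distr) auto
    ultimately show "(\<lambda>n. \<Sum>a\<in>A (r n). w (r n) a * f (x (r n) a)) \<longlonglongrightarrow> integral\<^sup>L (distr M borel P) f"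
      by simp
  qed simp
qed

section \<open>Riesz representation on test functions\<close>

text \<open>Dividing by \<open>C\<close> leaves total mass at most 1; the deficit becomes an extra
  atom, tagged \<open>None\<close>, at the origin. The condition \<open>f 0 = 0\<close> makes that
  atom invisible.\<close>

lemma discrete_measures_compact_le:
  fixes x :: "nat \<Rightarrow> 'k \<Rightarrow> real ^ 'n::finite" and w :: "nat \<Rightarrow> 'k \<Rightarrow> real"
  assumes A: "\<And>n. finite (A n)" and w0: "\<And>n a. a \<in> A n \<Longrightarrow> 0 \<le> w n a"
    and C: "C > 0" "\<And>n. (\<Sum>a\<in>A n. w n a) \<le> C"
    and x: "\<And>n a i. a \<in> A n \<Longrightarrow> 0 \<le> x n a $ i \<and> x n a $ i \<le> 1"
  obtains r \<nu> where "strict_mono r" "prob_space \<nu>" "sets \<nu> = sets borel"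
    "\<And>f :: real ^ 'n \<Rightarrow> real. continuous_on UNIV f \<Longrightarrow> f 0 = 0 \<Longrightarrow>
      (\<lambda>n. \<Sum>a\<in>A (r n). w (r n) a * f (x (r n) a)) \<longlonglongrightarrow> C * integral\<^sup>L \<nu> f"
proof -
  define w' where "w' n b = (case b of None \<Rightarrow> 1 - (\<Sum>a\<in>A n. w n a) / C | Some a \<Rightarrow> w n a / C)" for n b
  define x' where "x' n b = (case b of None \<Rightarrow> 0 | Some a \<Rightarrow> x n a)" for n b
  define A' where "A' n = insert None (Some ` A n)" for n
  have sum_A': "(\<Sum>b\<in>A' n. g b) = g None + (\<Sum>a\<in>A n. g (Some a))" for g :: "'k option \<Rightarrow> real" and n
    unfolding A'_def using A by (subst sum.insert) (auto simp: sum.reindex)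
  have p1: "finite (A' n)" for n by (simp add: A'_def A)
  have p2: "0 \<le> w' n b" if "b \<in> A' n" for n b
    using that w0 C by (auto simp: A'_def w'_def divide_le_eq)
  have p3: "(\<Sum>b\<in>A' n. w' n b) = 1" for n
    unfolding sum_A' by (simp add: w'_def sum_divide_distrib)
  have p4: "0 \<le> x' n b $ i \<and> x' n b $ i \<le> 1" if "b \<in> A' n" for n b i
    using that x by (auto simp: A'_def x'_def)
  obtain r \<nu> where r: "strict_mono r" "prob_space \<nu>" "sets \<nu> = sets borel"
    and lim: "\<And>f :: real ^ 'n \<Rightarrow> real. continuous_on UNIV f \<Longrightarrow>
      (\<lambda>n. \<Sum>a\<in>A' (r n). w' (r n) a * f (x' (r n) a)) \<longlonglongrightarrow> integral\<^sup>L \<nu> f"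
    using discrete_measures_compact[of A' w' x', OF p1 p2 p3 p4] by blast
  show ?thesis
  proof (rule that[OF r])
    fix f :: "real ^ 'n \<Rightarrow> real" assume f: "continuous_on UNIV f" "f 0 = 0"
    have "(\<Sum>a\<in>A' (r n). w' (r n) a * f (x' (r n) a)) = (\<Sum>a\<in>A (r n). w (r n) a * f (x (r n) a)) / C" for n
      unfolding sum_A' by (simp add: w'_def x'_def f sum_divide_distrib)
    with lim[OF f(1)] have "(\<lambda>n. C * ((\<Sum>a\<in>A (r n). w (r n) a * f (x (r n) a)) / C)) \<longlonglongrightarrow> C * integral\<^sup>L \<nu> f"
      by (intro tendsto_intros) simp
    then show "(\<lambda>n. \<Sum>a\<in>A (r n). w (r n) a * f (x (r n) a)) \<longlonglongrightarrow> C * integral\<^sup>L \<nu> f"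
      using C by simp
  qed
qed

section \<open>Smooth partitions of unity on grids\<close>

text \<open>A difference of consecutive steps, so that sums of integer translates telescope.\<close>

definition bump :: "real \<Rightarrow> real" where
  "bump t = smooth_step (t + 1) - smooth_step t"

lemma Ck_real_bump: "Ck_real n bump"
proof -
  have "Ck_real n (\<lambda>t. smooth_step (1 * t + 1) + (- 1) * smooth_step t)"
    by (intro Ck_real_add Ck_real_mult Ck_real_const Ck_real_affine Ck_real_smooth_step)
  then show ?thesis by (simp add: bump_def[abs_def])
qed

text \<open>One of the two steps is always saturated: for \<open>t \<le> 0\<close> the subtracted
  one is 0, otherwise the other one is 1.\<close>

lemma bump_nonneg: "bump t \<ge> 0"
  using smooth_step_nonneg[of "t + 1"] smooth_step_le_1[of t]
  by (cases "t \<le> 0") (auto simp: bump_def smooth_step_eq_0 smooth_step_eq_1)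

lemma bump_support: "bump t \<noteq> 0 \<Longrightarrow> \<bar>t\<bar> < 1"
  using smooth_step_eq_0[of "t + 1"] smooth_step_eq_0[of t] smooth_step_eq_1[of "t + 1"] smooth_step_eq_1[of t]
  by (cases "\<bar>t\<bar> < 1") (auto simp: bump_def abs_if split: if_splits)

text \<open>After telescoping only the two end steps survive. For \<open>2 \<le> y\<close> and
  \<open>y \<le> real n - 2\<close> the first is 1 and the second is 0, which is the partition of
  unity.\<close>

lemma sum_bump:
  assumes "n \<ge> 3"
  shows "(\<Sum>j=2..<n - 1. bump (y - real j)) = smooth_step (y - 1) - smooth_step (y - real n + 2)"
proof -
  have "(\<Sum>j=2..<n - 1. bump (y - real j)) =
      (\<Sum>j=2..<n - 1. (- smooth_step (y - real (Suc j) + 1)) - (- smooth_step (y - real j + 1)))"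
    by (intro sum.cong) (auto simp: bump_def algebra_simps)
  also have "\<dots> = - smooth_step (y - real (n - 1) + 1) - (- smooth_step (y - real 2 + 1))"
    by (rule sum_Suc_diff') (use assms in simp)
  finally show ?thesis using assms by (simp add: of_nat_diff algebra_simps)
qed

lemma sum_bump_le_1: "(\<Sum>j=2..<n - 1. bump (y - real j)) \<le> 1"
proof (cases "n \<ge> 3")
  case True
  show ?thesis unfolding sum_bump[OF True]
    using smooth_step_nonneg[of "y - real n + 2"] smooth_step_le_1[of "y - 1"] by simp
qed simp

lemma sum_bump_eq_1:
  assumes "2 \<le> y" "y \<le> real n - 2"
  shows "(\<Sum>j=2..<n - 1. bump (y - real j)) = 1"
proof -
  have "n \<ge> 3" using assms by linarith
  from sum_bump[OF this, of y] show ?thesis using assms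
    by (simp only: smooth_step_eq_0 smooth_step_eq_1)
qed

text \<open>Entries run from 2 to \<open>n - 2\<close>. A bump at \<open>k / n\<close> lives within
  \<open>1 / n\<close> of it, so leaving out the two outermost layers keeps every cell inside the
  closed cube with margin \<open>1 / n\<close>.\<close>

definition cells :: "nat \<Rightarrow> ('n::finite \<Rightarrow> nat) set" where
  "cells n = (\<Pi>\<^sub>E i\<in>UNIV. {2..<n - 1})"

definition cell :: "nat \<Rightarrow> ('n::finite \<Rightarrow> nat) \<Rightarrow> real ^ 'n \<Rightarrow> real" where
  "cell n k x = (\<Prod>i\<in>UNIV. bump (real n * x $ i - real (k i)))"

definition node :: "nat \<Rightarrow> ('n::finite \<Rightarrow> nat) \<Rightarrow> real ^ 'n" where
  "node n k = (\<chi> i. real (k i) / real n)"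

lemma finite_cells: "finite (cells n)"
  by (simp add: cells_def finite_PiE)

lemma cells_bounds: "k \<in> cells n \<Longrightarrow> 2 \<le> k i \<and> k i + 2 \<le> n"
proof -
  assume "k \<in> cells n"
  then have "k i \<in> {2..<n - 1}" by (auto simp: cells_def PiE_def Pi_def)
  then show ?thesis by auto
qed

lemma cell_nonneg: "cell n k x \<ge> 0"
  by (simp add: cell_def prod_nonneg bump_nonneg)

lemma cell_support: "cell n k x \<noteq> 0 \<Longrightarrow> \<bar>real n * x $ i - real (k i)\<bar> < 1"
  using bump_support by (fastforce simp: cell_def)

lemma sum_cells: "(\<Sum>k\<in>cells n. cell n k x) = (\<Prod>i\<in>UNIV. \<Sum>j=2..<n - 1. bump (real n * x $ i - real j))"
  unfolding cells_def cell_def by (rule prod_sum_PiE[symmetric]) auto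

lemma sum_cells_le_1: "(\<Sum>k\<in>cells n. cell n k x) \<le> 1"
  unfolding sum_cells by (intro prod_le_1 conjI sum_nonneg bump_nonneg sum_bump_le_1)

lemma node_bounds: "k \<in> cells n \<Longrightarrow> 0 \<le> node n k $ i \<and> node n k $ i \<le> 1"
  using cells_bounds[of k n i] by (auto simp: node_def divide_le_eq)

lemma cell_test_functions:
  fixes k :: "'n::finite \<Rightarrow> nat"
  assumes k: "k \<in> cells n"
  shows "cell n k \<in> test_functions"
proof (rule test_functionsI[of _ "cbox (\<chi> i. 1 / real n) (\<chi> i. 1 - 1 / real n)"])
  have n: "n \<ge> 4" using cells_bounds[OF k, of undefined] by linarith
  have "Ck_real m (\<lambda>t. bump (real n * t + - real (k i)))" for m i
    by (intro Ck_real_affine Ck_real_bump)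
  from Ck_component[OF this] show "Ck m (cell n k)" for m
    unfolding cell_def[abs_def] by (intro Ck_prod) auto
  have inv: "0 < 1 / real n" using n by simp
  show "cbox (\<chi> i. 1 / real n) (\<chi> i. 1 - 1 / real n) \<subseteq> (cube :: (real ^ 'n) set)"
  proof
    fix x :: "real ^ 'n" assume "x \<in> cbox (\<chi> i. 1 / real n) (\<chi> i. 1 - 1 / real n)"
    then have "1 / real n \<le> x $ i \<and> x $ i \<le> 1 - 1 / real n" for i by (simp add: mem_box_cart)
    with inv have "0 < x $ i \<and> x $ i < 1" for i by (smt (verit))
    then show "x \<in> cube" by (simp add: cube_def)
  qed
  fix x :: "real ^ 'n" assume x: "x \<notin> cbox (\<chi> i. 1 / real n) (\<chi> i. 1 - 1 / real n)"
  show "cell n k x = 0"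
  proof (rule ccontr)
    assume "cell n k x \<noteq> 0"
    then have "1 \<le> real n * x $ i \<and> real n * x $ i \<le> real n - 1" for i
      using cell_support[of n k x i] cells_bounds[OF k, of i] by linarith
    then have "1 / real n \<le> x $ i \<and> x $ i \<le> 1 - 1 / real n" for i
      using n by (simp add: field_simps)
    with x show False by (simp add: mem_box_cart)
  qed
qed auto

text \<open>For large \<open>n\<close> the cells sum to 1 on the support of \<open>f\<close>, and a
  cell that is nonzero at \<open>x\<close> has its node close to \<open>x\<close>, so uniform
  continuity bounds the error by an average of terms below \<open>e\<close>.\<close>

lemma cell_approximation:
  fixes f :: "real ^ 'n::finite \<Rightarrow> real"
  assumes f: "f \<in> test_functions" and e: "e > 0"
  shows "\<forall>\<^sub>F n in sequentially. \<forall>x. \<bar>f x - (\<Sum>k\<in>cells n. f (node n k) * cell n k x)\<bar> \<le> e"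
proof -
  obtain K where K: "compact K" "K \<subseteq> cube" "\<And>x. x \<notin> K \<Longrightarrow> f x = 0"
    using test_functionsE[OF f] by metis
  obtain \<delta> where \<delta>: "\<delta> > 0" "(\<Union>x\<in>K. cball x \<delta>) \<subseteq> cube"
    using compact_subset_open_imp_cball_epsilon_subset[OF K(1) open_cube K(2)] by blast
  \<comment> \<open>A shift by \<delta> along an axis, in either direction, remains in the
    cube.\<close>
  have margin: "\<delta> < x $ i \<and> x $ i < 1 - \<delta>" if "x \<in> K" for x i
  proof -
    have "x + a *\<^sub>R axis i 1 \<in> cube" if "\<bar>a\<bar> = \<delta>" for a
    proof -
      have "x + a *\<^sub>R axis i 1 \<in> cball x \<delta>" using that by (simp add: dist_norm)
      with \<delta>(2) \<open>x \<in> K\<close> show ?thesis by blast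
    qed
    from this[of \<delta>] this[of "- \<delta>"] have "x + \<delta> *\<^sub>R axis i 1 \<in> cube" "x + (- \<delta>) *\<^sub>R axis i 1 \<in> cube"
      using \<delta>(1) by auto
    then have "(x + \<delta> *\<^sub>R axis i 1) $ i < 1" "0 < (x + (- \<delta>) *\<^sub>R axis i 1) $ i"
      unfolding cube_def by blast+
    then show ?thesis by simp
  qed
  have "uniformly_continuous_on (cbox 0 1) f"
    by (intro compact_uniformly_continuous test_functions_continuous f) auto
  then obtain d where d: "d > 0" "\<And>x y. x \<in> cbox 0 1 \<Longrightarrow> y \<in> cbox 0 1 \<Longrightarrow> dist y x < d \<Longrightarrow> dist (f y) (f x) < e"
    using e unfolding uniformly_continuous_on_def by metis
  \<comment> \<open>The first bound makes \<open>n * x $ i\<close> lie in \<open>[2, n - 2]\<close>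
    for \<open>x\<close> in \<open>K\<close>, where the cells sum to 1. The second brings nodes
    within \<open>d\<close>: each coordinate differs by less than \<open>1 / n\<close>, and the norm
    is at most the sum of the coordinates.\<close>
  have "\<forall>\<^sub>F n in sequentially. 2 / \<delta> < real n \<and> real CARD('n) / d < real n"
    by (intro eventually_conj filterlim_real_sequentially[unfolded filterlim_at_top_dense, rule_format])
  then show ?thesis
  proof eventually_elim
    case (elim n)
    have n0: "real n > 0" using elim \<delta>(1) by (meson divide_pos_pos less_trans zero_less_numeral)
    show ?case
    proof
      fix x
      show "\<bar>f x - (\<Sum>k\<in>cells n. f (node n k) * cell n k x)\<bar> \<le> e"
      proof (cases "x \<in> cube")
        case False
        then have "cell n k x = 0" if "k \<in> cells n" for k
          using test_functions_zero_outside[OF cell_test_functions[OF that]] by simp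
        then show ?thesis using False e test_functions_zero_outside[OF f] by simp
      next
        case True
        \<comment> \<open>Off \<open>K\<close> both sides are 0, whatever the cells sum to
          there.\<close>
        have fx: "f x = (\<Sum>k\<in>cells n. f x * cell n k x)"
        proof (cases "x \<in> K")
          case True
          have "2 \<le> real n * x $ i \<and> real n * x $ i \<le> real n - 2" for i
          proof -
            have "2 < real n * \<delta>" using elim \<delta>(1) by (simp add: divide_less_eq)
            moreover have "real n * \<delta> \<le> real n * x $ i" "real n * x $ i \<le> real n * (1 - \<delta>)"
              using margin[OF True, of i] n0 by (auto intro!: mult_left_mono)
            ultimately show ?thesis by (simp add: algebra_simps)
          qed
          then have "(\<Sum>k\<in>cells n. cell n k x) = 1"
            unfolding sum_cells by (intro prod.neutral ballI sum_bump_eq_1) auto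
          then show ?thesis by (simp add: sum_distrib_left[symmetric])
        qed (simp add: K)
        have "\<bar>f x - (\<Sum>k\<in>cells n. f (node n k) * cell n k x)\<bar> = \<bar>\<Sum>k\<in>cells n. (f x - f (node n k)) * cell n k x\<bar>"
          by (subst fx) (simp add: sum_subtractf left_diff_distrib)
        also have "\<dots> \<le> (\<Sum>k\<in>cells n. \<bar>(f x - f (node n k)) * cell n k x\<bar>)" by (rule sum_abs)
        also have "\<dots> \<le> (\<Sum>k\<in>cells n. e * cell n k x)"
        proof (rule sum_mono)
          fix k :: "'n \<Rightarrow> nat" assume k: "k \<in> cells n"
          show "\<bar>(f x - f (node n k)) * cell n k x\<bar> \<le> e * cell n k x"
          proof (cases "cell n k x = 0")
            case False
            have "norm (x - node n k) \<le> (\<Sum>i\<in>UNIV. \<bar>(x - node n k) $ i\<bar>)" by (rule norm_le_l1_cart)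
            also have "\<dots> \<le> (\<Sum>i\<in>(UNIV :: 'n set). 1 / real n)"
            proof (rule sum_mono)
              fix i
              have "(x - node n k) $ i = (real n * x $ i - real (k i)) / real n"
                using n0 by (simp add: node_def field_simps)
              then show "\<bar>(x - node n k) $ i\<bar> \<le> 1 / real n"
                using cell_support[OF False, of i] n0 by (simp add: divide_right_mono)
            qed
            also have "\<dots> < d" using elim d(1) n0 by (simp add: field_simps)
            finally have "dist x (node n k) < d" by (simp add: dist_norm)
            then have "dist (f x) (f (node n k)) < e"
              using True node_bounds[OF k] by (intro d(2)) (auto simp: mem_box_cart cube_def less_imp_le)
            then show ?thesis using cell_nonneg[of n k x]
              by (simp add: abs_mult dist_real_def mult_right_mono)
          qed simp
        qed
        also have "\<dots> = e * (\<Sum>k\<in>cells n. cell n k x)" by (simp add: sum_distrib_left)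
        also have "\<dots> \<le> e * 1" using e by (intro mult_left_mono sum_cells_le_1) simp
        finally show ?thesis by simp
      qed
    qed
  qed
qed

text \<open>The discrete functional \<open>D n\<close> is \<open>L\<close> evaluated at the cell
  approximation of \<open>f\<close>, so the supremum bound forces it to tend to \<open>L f\<close>;
  along a subsequence it also tends to the integrals against the limit measures. These live on the
  whole space and may charge the boundary of the cube.\<close>

lemma Riesz_test_functions:
  fixes L :: "(real ^ 'n::finite \<Rightarrow> real) \<Rightarrow> real"
  assumes lin: "\<And>f g a b. f \<in> test_functions \<Longrightarrow> g \<in> test_functions \<Longrightarrow>
      L (\<lambda>x. a * f x + b * g x) = a * L f + b * L g"
    and bound: "\<And>f. f \<in> test_functions \<Longrightarrow> (\<And>x. \<bar>f x\<bar> \<le> 1) \<Longrightarrow> L f \<le> M"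
  obtains C \<nu> \<nu>' where "prob_space \<nu>" "sets \<nu> = sets borel" "prob_space \<nu>'" "sets \<nu>' = sets borel"
    "\<And>f. f \<in> test_functions \<Longrightarrow> L f = C * (integral\<^sup>L \<nu> f - integral\<^sup>L \<nu>' f)"
proof -
  have L0: "L (\<lambda>x. 0) = 0" using lin[OF test_functions_zero test_functions_zero, of 0 0] by simp
  have Lsum: "L (\<lambda>x. \<Sum>i\<in>I. a i * f i x) = (\<Sum>i\<in>I. a i * L (f i))"
    if "finite I" "\<And>i. i \<in> I \<Longrightarrow> f i \<in> test_functions" for I :: "'k set" and a f
    using that
  proof (induction I rule: finite_induct)
    case (insert j I)
    have "(\<lambda>x. \<Sum>i\<in>I. a i * f i x) \<in> test_functions"
      using insert by (intro test_functions_sum test_functions_cmult) auto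
    with insert lin[of "f j" "\<lambda>x. \<Sum>i\<in>I. a i * f i x" "a j" 1] show ?case by simp
  qed (simp add: L0)
  have M0: "0 \<le> M" using bound[OF test_functions_zero] L0 by simp
  \<comment> \<open>Adding 1 keeps \<open>C\<close> positive when \<open>M = 0\<close> and later
    gives the strict inequality \<open>e / C * M < e\<close>.\<close>
  define C where "C = M + 1"
  have C: "C > 0" using M0 by (simp add: C_def)
  have small: "\<bar>L f\<bar> \<le> e * M" if f: "f \<in> test_functions" "\<And>x. \<bar>f x\<bar> \<le> e" and e: "e > 0" for f e
  proof -
    have scale: "L (\<lambda>x. c * f x) = c * L f" for c
      using lin[OF f(1) test_functions_zero, of c 0] by simp
    \<comment> \<open>Both signs of \<open>c\<close> are used, which turns the one-sided bound into
      a bound on the absolute value.\<close>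
    have "c * L f \<le> M" if "\<bar>c\<bar> = 1 / e" for c
    proof -
      have "\<bar>c * f x\<bar> \<le> 1" for x
        using f(2)[of x] e by (simp add: abs_mult that divide_le_eq)
      from bound[OF test_functions_cmult[OF f(1)] this] show ?thesis by (simp add: scale)
    qed
    from this[of "1 / e"] this[of "- 1 / e"] e have "L f / e \<le> M" "(- L f) / e \<le> M"
      by simp_all
    with e have "L f \<le> M * e" "- L f \<le> M * e" by (simp_all only: pos_divide_le_eq)
    then show ?thesis by (simp add: mult.commute abs_le_iff)
  qed
  define c where "c n k = L (cell n k)" for n and k :: "'n \<Rightarrow> nat"
  have mass: "(\<Sum>k\<in>cells n. \<bar>c n k\<bar>) \<le> C" for n
  proof -
    \<comment> \<open>The total variation is attained at the combination of cells with the signs of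
      the weights, a test function bounded by 1 because the cells sum to at most 1.\<close>
    have "(\<Sum>k\<in>cells n. \<bar>c n k\<bar>) = (\<Sum>k\<in>cells n. sgn (c n k) * L (cell n k))"
      by (intro sum.cong) (auto simp: c_def sgn_if)
    also have "\<dots> = L (\<lambda>x. \<Sum>k\<in>cells n. sgn (c n k) * cell n k x)"
      by (rule Lsum[symmetric]) (auto simp: finite_cells cell_test_functions)
    also have "\<dots> \<le> M"
    proof (rule bound)
      show "(\<lambda>x. \<Sum>k\<in>cells n. sgn (c n k) * cell n k x) \<in> test_functions"
        by (intro test_functions_sum test_functions_cmult finite_cells cell_test_functions)
      fix x
      have "\<bar>\<Sum>k\<in>cells n. sgn (c n k) * cell n k x\<bar> \<le> (\<Sum>k\<in>cells n. \<bar>sgn (c n k) * cell n k x\<bar>)"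
        by (rule sum_abs)
      also have "\<dots> \<le> (\<Sum>k\<in>cells n. cell n k x)"
        by (intro sum_mono) (auto simp: abs_mult sgn_if cell_nonneg)
      also have "\<dots> \<le> 1" by (rule sum_cells_le_1)
      finally show "\<bar>\<Sum>k\<in>cells n. sgn (c n k) * cell n k x\<bar> \<le> 1" .
    qed
    finally show ?thesis by (simp add: C_def)
  qed
  have masses: "(\<Sum>k\<in>cells n. max 0 (c n k)) \<le> C" "(\<Sum>k\<in>cells n. max 0 (- c n k)) \<le> C" for n
    by (rule order_trans[OF sum_mono mass[of n]], simp)+
  obtain r \<nu> where r: "strict_mono r" "prob_space \<nu>" "sets \<nu> = sets borel"
    and lim: "\<And>f :: real ^ 'n \<Rightarrow> real. continuous_on UNIV f \<Longrightarrow> f 0 = 0 \<Longrightarrow>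
      (\<lambda>n. \<Sum>k\<in>cells (r n). max 0 (c (r n) k) * f (node (r n) k)) \<longlonglongrightarrow> C * integral\<^sup>L \<nu> f"
    using discrete_measures_compact_le[of cells "\<lambda>n k. max 0 (c n k)" C node,
        OF finite_cells max.cobounded1 C masses(1) node_bounds] by blast
  \<comment> \<open>The negative parts are thinned out along the subsequence already chosen, so both
    limits hold along \<open>r (s n)\<close>.\<close>
  obtain s \<nu>' where s: "strict_mono s" "prob_space \<nu>'" "sets \<nu>' = sets borel"
    and lim': "\<And>f :: real ^ 'n \<Rightarrow> real. continuous_on UNIV f \<Longrightarrow> f 0 = 0 \<Longrightarrow>
      (\<lambda>n. \<Sum>k\<in>cells (r (s n)). max 0 (- c (r (s n)) k) * f (node (r (s n)) k)) \<longlonglongrightarrow> C * integral\<^sup>L \<nu>' f"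
    using discrete_measures_compact_le[of "\<lambda>n. cells (r n)" "\<lambda>n k. max 0 (- c (r n) k)" C "\<lambda>n. node (r n)",
        OF finite_cells max.cobounded1 C masses(2) node_bounds] by blast
  show ?thesis
  proof (rule that[OF r(2,3) s(2,3), of C])
    fix f :: "real ^ 'n \<Rightarrow> real" assume f: "f \<in> test_functions"
    have f0: "f 0 = 0" using test_functions_zero_outside[OF f, of 0] by (simp add: cube_def)
    note fc = test_functions_continuous[OF f, of UNIV]
    define D where "D n = (\<Sum>k\<in>cells n. c n k * f (node n k))" for n
    have "D \<longlonglongrightarrow> L f"
    proof (rule LIMSEQ_I)
      fix e :: real assume e: "e > 0"
      have "\<forall>\<^sub>F n in sequentially. \<forall>x. \<bar>f x - (\<Sum>k\<in>cells n. f (node n k) * cell n k x)\<bar> \<le> e / C"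
        using e C by (intro cell_approximation f) simp
      then obtain m where m: "\<And>n x. n \<ge> m \<Longrightarrow> \<bar>f x - (\<Sum>k\<in>cells n. f (node n k) * cell n k x)\<bar> \<le> e / C"
        unfolding eventually_sequentially by blast
      have "norm (D n - L f) < e" if n: "n \<ge> m" for n
      proof -
        define g where "g x = (\<Sum>k\<in>cells n. f (node n k) * cell n k x)" for x
        have g: "g \<in> test_functions" unfolding g_def[abs_def]
          by (intro test_functions_sum test_functions_cmult finite_cells cell_test_functions)
        have "L g = D n" unfolding g_def[abs_def] D_def
          by (subst Lsum) (auto simp: finite_cells cell_test_functions c_def mult.commute)
        then have "L (\<lambda>x. 1 * f x + (- 1) * g x) = L f - D n" using lin[OF f g, of 1 "-1"] by simp
        moreover have "\<bar>L (\<lambda>x. 1 * f x + (- 1) * g x)\<bar> \<le> e / C * M"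
          using m[OF n] e C by (intro small test_functions_linear f g) (auto simp: g_def)
        moreover have "e / C * M < e" using e C M0 by (simp add: C_def field_simps)
        ultimately show ?thesis by simp
      qed
      then show "\<exists>m. \<forall>n\<ge>m. norm (D n - L f) < e" by blast
    qed
    then have "(\<lambda>n. D (r (s n))) \<longlonglongrightarrow> L f"
      using LIMSEQ_subseq_LIMSEQ[OF _ strict_mono_o[OF r(1) s(1)], of D "L f"] by (simp add: o_def)
    moreover have "(\<lambda>n. D (r (s n))) \<longlonglongrightarrow> C * integral\<^sup>L \<nu> f - C * integral\<^sup>L \<nu>' f"
    proof -
      have "D n = (\<Sum>k\<in>cells n. max 0 (c n k) * f (node n k)) - (\<Sum>k\<in>cells n. max 0 (- c n k) * f (node n k))" for n
        unfolding D_def sum_subtractf[symmetric] by (intro sum.cong) (auto simp: max_def)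
      moreover have "(\<lambda>n. \<Sum>k\<in>cells (r (s n)). max 0 (c (r (s n)) k) * f (node (r (s n)) k)) \<longlonglongrightarrow> C * integral\<^sup>L \<nu> f"
        using LIMSEQ_subseq_LIMSEQ[OF lim[OF fc f0] s(1)] by (simp add: o_def)
      ultimately show ?thesis using tendsto_diff[OF _ lim'[OF fc f0]] by simp
    qed
    ultimately show "L f = C * (integral\<^sup>L \<nu> f - integral\<^sup>L \<nu>' f)"
      using LIMSEQ_unique by (fastforce simp: right_diff_distrib)
  qed
qed

section \<open>Polar decomposition\<close>

lemma prob_space_imp_finite: "prob_space M \<Longrightarrow> finite_measure M"
  by (simp add: prob_space_def)

text \<open>The sum of the measures is finite, and its null sets are null for each summand.\<close>

lemma sum_of_measures:
  fixes \<nu> :: "'i \<Rightarrow> 'a::topological_space measure"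
  assumes I: "finite I" and \<nu>: "\<And>i. i \<in> I \<Longrightarrow> finite_measure (\<nu> i)" "\<And>i. i \<in> I \<Longrightarrow> sets (\<nu> i) = sets borel"
  obtains \<Lambda> where "finite_measure \<Lambda>" "sets \<Lambda> = sets borel" "\<And>i. i \<in> I \<Longrightarrow> absolutely_continuous \<Lambda> (\<nu> i)"
proof -
  define \<Lambda> where "\<Lambda> = measure_of UNIV (sets borel) (\<lambda>A. \<Sum>i\<in>I. emeasure (\<nu> i) A)"
  have s: "sets \<Lambda> = sets borel" unfolding \<Lambda>_def
    by (metis sets.sigma_sets_eq sets_measure_of sets.space_closed space_borel)
  have em: "emeasure \<Lambda> A = (\<Sum>i\<in>I. emeasure (\<nu> i) A)" if "A \<in> sets borel" for A
  proof (rule emeasure_measure_of[OF \<Lambda>_def])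
    show "positive (sets \<Lambda>) (\<lambda>A. \<Sum>i\<in>I. emeasure (\<nu> i) A)" by (simp add: positive_def)
    show "countably_additive (sets \<Lambda>) (\<lambda>A. \<Sum>i\<in>I. emeasure (\<nu> i) A)"
    proof (rule countably_additiveI)
      fix A :: "nat \<Rightarrow> 'a set" assume A: "range A \<subseteq> sets \<Lambda>" "disjoint_family A"
      have "(\<Sum>j. \<Sum>i\<in>I. emeasure (\<nu> i) (A j)) = (\<Sum>i\<in>I. \<Sum>j. emeasure (\<nu> i) (A j))"
        by (rule suminf_sum) simp
      also have "\<dots> = (\<Sum>i\<in>I. emeasure (\<nu> i) (\<Union>(range A)))"
        using A s \<nu>(2) by (intro sum.cong suminf_emeasure) auto
      finally show "(\<Sum>j. \<Sum>i\<in>I. emeasure (\<nu> i) (A j)) = (\<Sum>i\<in>I. emeasure (\<nu> i) (\<Union>(range A)))" .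
    qed
  qed (use that s in auto)
  show ?thesis
  proof (rule that[OF _ s])
    have sp: "space \<Lambda> = UNIV" using sets_eq_imp_space_eq[OF s] by simp
    show "finite_measure \<Lambda>"
    proof
      have "emeasure (\<nu> i) UNIV \<noteq> \<infinity>" if "i \<in> I" for i
        using finite_measure.emeasure_finite[OF \<nu>(1)[OF that]] by simp
      then show "emeasure \<Lambda> (space \<Lambda>) \<noteq> \<infinity>"
        unfolding sp em[OF sets.top[of borel, unfolded space_borel]] using I by simp
    qed
    show "absolutely_continuous \<Lambda> (\<nu> i)" if "i \<in> I" for i
    proof -
      have "emeasure (\<nu> i) N = 0" if N: "N \<in> sets borel" "emeasure \<Lambda> N = 0" for N
        using N em[OF N(1)] I \<open>i \<in> I\<close> by simp
      then show ?thesis using s \<nu>(2)[OF that] by (auto simp: absolutely_continuous_def null_sets_def)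
    qed
  qed
qed

text \<open>The density is \<open>C\<close> times the difference of the two Radon-Nikodym
  derivatives. Test functions are bounded, so their products with it are integrable.\<close>

lemma signed_density:
  fixes \<nu> \<nu>' \<Lambda> :: "(real ^ 'n::finite) measure"
  assumes \<Lambda>: "finite_measure \<Lambda>" "sets \<Lambda> = sets borel"
    and \<nu>: "prob_space \<nu>" "sets \<nu> = sets borel" "absolutely_continuous \<Lambda> \<nu>"
    and \<nu>': "prob_space \<nu>'" "sets \<nu>' = sets borel" "absolutely_continuous \<Lambda> \<nu>'"
  obtains s where "s \<in> borel_measurable borel" "integrable \<Lambda> s"
    "\<And>f. f \<in> test_functions \<Longrightarrow> integrable \<Lambda> (\<lambda>x. f x * s x) \<and>
      C * (integral\<^sup>L \<nu> f - integral\<^sup>L \<nu>' f) = integral\<^sup>L \<Lambda> (\<lambda>x. f x * s x)"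
proof -
  interpret \<Lambda>: finite_measure \<Lambda> by (rule \<Lambda>)
  have dens: "\<exists>D :: real ^ 'n \<Rightarrow> real. D \<in> borel_measurable borel \<and> integrable \<Lambda> D \<and>
      (\<forall>f\<in>borel_measurable borel. integral\<^sup>L \<nu> f = (LINT x|\<Lambda>. D x * f x))"
    if \<nu>: "prob_space \<nu>" "sets \<nu> = sets borel" "absolutely_continuous \<Lambda> \<nu>" for \<nu>
  proof -
    interpret \<nu>: prob_space \<nu> by (rule \<nu>)
    have s: "sets \<nu> = sets \<Lambda>" using \<Lambda> \<nu> by simp
    have m: "borel_measurable borel = (borel_measurable \<Lambda> :: (real ^ 'n \<Rightarrow> real) set)"
      by (rule measurable_cong_sets) (simp_all add: \<Lambda>)
    note R = \<Lambda>.RN_deriv_integrable[OF \<nu>.sigma_finite_measure_axioms \<nu>(3) s]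
      \<Lambda>.RN_deriv_integral[OF \<nu>.sigma_finite_measure_axioms \<nu>(3) s]
    have "integrable \<Lambda> (\<lambda>x. enn2real (RN_deriv \<Lambda> \<nu> x) * 1)"
      by (subst R(1)[symmetric]) auto
    then have "integrable \<Lambda> (\<lambda>x. enn2real (RN_deriv \<Lambda> \<nu> x))" by simp
    then show ?thesis
    proof (intro exI[of _ "\<lambda>x. enn2real (RN_deriv \<Lambda> \<nu> x)"] conjI ballI)
      show "(\<lambda>x. enn2real (RN_deriv \<Lambda> \<nu> x)) \<in> borel_measurable borel"
        unfolding m by measurable
      show "integral\<^sup>L \<nu> f = (LINT x|\<Lambda>. enn2real (RN_deriv \<Lambda> \<nu> x) * f x)"
        if "f \<in> borel_measurable borel" for f :: "real ^ 'n \<Rightarrow> real"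
        using that unfolding m by (rule R(2))
    qed
  qed
  obtain D :: "real ^ 'n \<Rightarrow> real" where D: "D \<in> borel_measurable borel" "integrable \<Lambda> D"
    "\<And>f. f \<in> borel_measurable borel \<Longrightarrow> integral\<^sup>L \<nu> f = (LINT x|\<Lambda>. D x * f x)"
    using dens[OF \<nu>] by blast
  obtain D' :: "real ^ 'n \<Rightarrow> real" where D': "D' \<in> borel_measurable borel" "integrable \<Lambda> D'"
    "\<And>f. f \<in> borel_measurable borel \<Longrightarrow> integral\<^sup>L \<nu>' f = (LINT x|\<Lambda>. D' x * f x)"
    using dens[OF \<nu>'] by blast
  show ?thesis
  proof (rule that[of "\<lambda>x. C * (D x - D' x)"])
    show "(\<lambda>x. C * (D x - D' x)) \<in> borel_measurable borel" using D D' by simp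
    show "integrable \<Lambda> (\<lambda>x. C * (D x - D' x))" using D D' by simp
    fix f :: "real ^ 'n \<Rightarrow> real" assume f: "f \<in> test_functions"
    obtain K where K: "compact K" "K \<subseteq> cube" "\<And>x. x \<notin> K \<Longrightarrow> f x = 0"
      using test_functionsE[OF f] by metis
    note fc = test_functions_continuous[OF f, of UNIV]
    obtain G where G: "\<And>x. \<bar>f x\<bar> \<le> G" "G > 0"
      using bounded_compact_support[OF fc K(1,3)] by blast
    have fm: "f \<in> borel_measurable borel" by (rule borel_measurable_continuous_onI[OF fc])
    have "f \<in> borel_measurable \<Lambda>" using fm measurable_cong_sets[OF \<Lambda>(2) refl] by blast
    note i = integrable_mult_bounded[OF _ this G(1)]
    have eq: "(\<lambda>x. f x * (C * (D x - D' x))) = (\<lambda>x. C * (D x * f x - D' x * f x))"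
      by (auto simp: algebra_simps)
    show "integrable \<Lambda> (\<lambda>x. f x * (C * (D x - D' x))) \<and>
      C * (integral\<^sup>L \<nu> f - integral\<^sup>L \<nu>' f) = integral\<^sup>L \<Lambda> (\<lambda>x. f x * (C * (D x - D' x)))"
      unfolding eq D(3)[OF fm] D'(3)[OF fm] using i[OF D(2)] i[OF D'(2)] by simp
  qed
qed

section \<open>Component functionals and the vector measure\<close>

lemma pderivs_linear:
  assumes "f \<in> test_functions" "g \<in> test_functions"
  shows "pderivs w (\<lambda>x. a * f x + b * g x) = (\<lambda>x. a * pderivs w f x + b * pderivs w g x)"
proof (induction w)
  case (Cons i w)
  show ?case unfolding pderivs.simps Cons
    by (intro ext partial_linear test_functions_differentiable test_functions_pderivs assms)
qed simp

lemma adjoint_entry_linear: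
  assumes "f \<in> test_functions" "g \<in> test_functions"
  shows "adjoint_entry B w (\<lambda>x. a * f x + b * g x) x = a * adjoint_entry B w f x + b * adjoint_entry B w g x"
  by (simp add: adjoint_entry_def pderivs_linear[OF assms] sum.distrib sum_distrib_left algebra_simps)

lemma adjoint_entry_zero: "adjoint_entry B w (\<lambda>x. 0) x = 0"
  using adjoint_entry_linear[OF test_functions_zero test_functions_zero, of B w 0 0] by simp

lemma set_integrable_L1_test:
  fixes u :: "real ^ 'n::finite \<Rightarrow> real"
  assumes u: "u \<in> L1_cube" and g: "g \<in> test_functions"
  shows "set_integrable lebesgue cube (\<lambda>x. u x * g x)"
proof -
  obtain K where K: "compact K" "K \<subseteq> cube" "\<And>x. x \<notin> K \<Longrightarrow> g x = 0"
    using test_functionsE[OF g] by metis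
  note gc = test_functions_continuous[OF g, of UNIV]
  obtain G where G: "\<And>x. \<bar>g x\<bar> \<le> G" "G > 0"
    using bounded_compact_support[OF gc K(1,3)] by blast
  have gm: "g \<in> borel_measurable lebesgue"
    using borel_measurable_continuous_onI[OF gc] by (simp add: measurable_completion)
  have iu: "integrable lebesgue (\<lambda>x. indicator cube x * u x)"
    using u by (simp add: L1_cube_def set_integrable_def)
  have "integrable lebesgue (\<lambda>x. (indicator cube x * u x) * g x)"
    using iu gm G(1) by (rule integrable_mult_bounded)
  then show ?thesis by (simp add: set_integrable_def mult.assoc)
qed

text \<open>A scalar test function placed in slot \<open>w\<close>, with zeros elsewhere, has
  Euclidean norm equal to its absolute value. Hence the variation bounds every component functional
  on scalar test functions bounded by 1, and each one has a representing signed measure.\<close>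

lemma BV_structure:
  fixes u :: "real ^ 'n::finite \<Rightarrow> real"
  assumes u: "u \<in> BV d B"
  shows "\<exists>\<Lambda> s. finite_measure \<Lambda> \<and> sets \<Lambda> = sets borel \<and>
    (\<forall>w\<in>multi_indices d. s w \<in> borel_measurable borel \<and> integrable \<Lambda> (s w)) \<and>
    (\<forall>\<phi>\<in>vector_test_functions d. (LINT x:cube|lebesgue. u x * formal_adjoint d B \<phi> x) =
      (LINT x|\<Lambda>. (\<Sum>w\<in>multi_indices d. \<phi> x w * s w x)))"
proof -
  let ?I = "multi_indices d :: 'n list set"
  have u1: "u \<in> L1_cube" and "PV d B u \<noteq> \<infinity>" using u by (auto simp: BV_def)
  then obtain M :: nat where M: "PV d B u < ereal (real M)"
    using less_PInf_Ex_of_nat by blast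
  define L where "L w f = (LINT x:cube|lebesgue. u x * adjoint_entry B w f x)" for w f
  have sum_L: "(LINT x:cube|lebesgue. u x * formal_adjoint d B \<phi> x) = (\<Sum>w\<in>?I. L w (\<lambda>x. \<phi> x w))"
    if \<phi>: "\<phi> \<in> vector_test_functions d" for \<phi>
  proof -
    have "(\<lambda>x. \<phi> x w) \<in> test_functions" if "w \<in> ?I" for w
      using \<phi> that by (auto simp: vector_test_functions_def)
    then show ?thesis unfolding L_def formal_adjoint_eq[OF \<phi>] explicit_adjoint_def sum_distrib_left
      by (intro set_lebesgue_integral_sum set_integrable_L1_test u1 adjoint_entry_test_functions)
  qed
  have L_linear: "L w (\<lambda>x. a * f x + b * g x) = a * L w f + b * L w g"
    if f: "f \<in> test_functions" and g: "g \<in> test_functions" for w f g a b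
  proof -
    note i = set_integrable_L1_test[OF u1 adjoint_entry_test_functions[OF f, of B w]]
      set_integrable_L1_test[OF u1 adjoint_entry_test_functions[OF g, of B w]]
    have "L w (\<lambda>x. a * f x + b * g x) = (LINT x:cube|lebesgue.
        a * (u x * adjoint_entry B w f x) + b * (u x * adjoint_entry B w g x))"
      unfolding L_def by (simp add: adjoint_entry_linear[OF f g] algebra_simps)
    also have "\<dots> = a * L w f + b * L w g"
      unfolding L_def using i by (subst set_integral_add(2)) (auto intro: set_integrable_mult_right)
    finally show ?thesis .
  qed
  have L_bound: "L w f \<le> real M"
    if w: "w \<in> ?I" and f: "f \<in> test_functions" and f1: "\<And>x. \<bar>f x\<bar> \<le> 1" for w f
  proof -
    define \<phi> where "\<phi> x v = (if v = w then f x else 0)" for x v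
    have \<phi>: "\<phi> \<in> vector_test_functions d"
      unfolding vector_test_functions_def
    proof safe
      fix v :: "'n list"
      show "(\<lambda>x. \<phi> x v) \<in> test_functions"
        by (cases "v = w") (simp_all add: \<phi>_def f test_functions_zero)
    qed
    have "L2_set (\<phi> x) ?I \<le> 1" for x
    proof -
      have "(\<Sum>v\<in>?I. (\<phi> x v)\<^sup>2) = (\<Sum>v\<in>?I. if v = w then (f x)\<^sup>2 else 0)"
        by (intro sum.cong) (auto simp: \<phi>_def)
      also have "\<dots> = (f x)\<^sup>2" using w by (simp add: finite_multi_indices)
      finally show ?thesis using f1[of x] by (simp add: L2_set_def)
    qed
    then have "ereal (LINT x:cube|lebesgue. u x * formal_adjoint d B \<phi> x) \<le> PV d B u"
      unfolding PV_def using \<phi> by (intro SUP_upper) simp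
    from le_less_trans[OF this M]
    have "(LINT x:cube|lebesgue. u x * formal_adjoint d B \<phi> x) \<le> real M" by simp
    moreover have "L v (\<lambda>x. \<phi> x v) = (if v = w then L w f else 0)" for v
      by (auto simp: \<phi>_def L_def adjoint_entry_zero)
    then have "(\<Sum>v\<in>?I. L v (\<lambda>x. \<phi> x v)) = L w f"
      using w by (simp add: finite_multi_indices)
    ultimately show ?thesis by (simp add: sum_L[OF \<phi>])
  qed
  have "\<exists>C \<nu> \<nu>'. prob_space \<nu> \<and> sets \<nu> = sets borel \<and> prob_space \<nu>' \<and> sets \<nu>' = sets borel \<and>
      (\<forall>f\<in>test_functions. L w f = C * (integral\<^sup>L \<nu> f - integral\<^sup>L \<nu>' f))" if w: "w \<in> ?I" for w
    by (rule Riesz_test_functions[of "L w" "real M"]) (use L_linear L_bound[OF w] in blast)+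
  then obtain C \<nu> \<nu>' where \<nu>: "\<And>w. w \<in> ?I \<Longrightarrow> prob_space (\<nu> w)" "\<And>w. w \<in> ?I \<Longrightarrow> sets (\<nu> w) = sets borel"
    and \<nu>': "\<And>w. w \<in> ?I \<Longrightarrow> prob_space (\<nu>' w)" "\<And>w. w \<in> ?I \<Longrightarrow> sets (\<nu>' w) = sets borel"
    and L: "\<And>w f. w \<in> ?I \<Longrightarrow> f \<in> test_functions \<Longrightarrow> L w f = C w * (integral\<^sup>L (\<nu> w) f - integral\<^sup>L (\<nu>' w) f)"
    by metis
  \<comment> \<open>The Boolean tag lists both measures of every component in one finite family, so
    that a single \<Lambda> dominates them all.\<close>
  define N where "N p = (if snd p then \<nu> (fst p) else \<nu>' (fst p))" for p :: "'n list \<times> bool"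
  obtain \<Lambda> where \<Lambda>: "finite_measure \<Lambda>" "sets \<Lambda> = sets borel"
    and ac: "\<And>p. p \<in> ?I \<times> UNIV \<Longrightarrow> absolutely_continuous \<Lambda> (N p)"
  proof (rule sum_of_measures[of "?I \<times> (UNIV :: bool set)" N])
    show "finite (?I \<times> (UNIV :: bool set))" by (simp add: finite_multi_indices)
    show "finite_measure (N p)" "sets (N p) = sets borel" if "p \<in> ?I \<times> UNIV" for p
      using that \<nu> \<nu>' by (auto simp: N_def prob_space_imp_finite)
  qed blast
  have ac1: "absolutely_continuous \<Lambda> (\<nu> w)" "absolutely_continuous \<Lambda> (\<nu>' w)" if "w \<in> ?I" for w
    using ac[of "(w, True)"] ac[of "(w, False)"] that by (simp_all add: N_def)
  have "\<forall>w\<in>?I. \<exists>s. s \<in> borel_measurable borel \<and> integrable \<Lambda> s \<and>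
    (\<forall>f\<in>test_functions. integrable \<Lambda> (\<lambda>x. f x * s x) \<and>
      C w * (integral\<^sup>L (\<nu> w) f - integral\<^sup>L (\<nu>' w) f) = integral\<^sup>L \<Lambda> (\<lambda>x. f x * s x))"
  proof
    fix w assume w: "w \<in> ?I"
    show "\<exists>s. s \<in> borel_measurable borel \<and> integrable \<Lambda> s \<and>
      (\<forall>f\<in>test_functions. integrable \<Lambda> (\<lambda>x. f x * s x) \<and>
        C w * (integral\<^sup>L (\<nu> w) f - integral\<^sup>L (\<nu>' w) f) = integral\<^sup>L \<Lambda> (\<lambda>x. f x * s x))"
      by (rule signed_density[OF \<Lambda> \<nu>(1,2)[OF w] ac1(1)[OF w] \<nu>'(1,2)[OF w] ac1(2)[OF w], of "C w"]) blast
  qed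
  from bchoice[OF this] obtain s where s: "\<forall>w\<in>?I. s w \<in> borel_measurable borel \<and> integrable \<Lambda> (s w) \<and>
    (\<forall>f\<in>test_functions. integrable \<Lambda> (\<lambda>x. f x * s w x) \<and>
      C w * (integral\<^sup>L (\<nu> w) f - integral\<^sup>L (\<nu>' w) f) = integral\<^sup>L \<Lambda> (\<lambda>x. f x * s w x))"
    by (elim exE)
  show ?thesis
  proof (intro exI[of _ \<Lambda>] exI[of _ s] conjI ballI \<Lambda>)
    show "s w \<in> borel_measurable borel" "integrable \<Lambda> (s w)" if "w \<in> ?I" for w
      using bspec[OF s that] by simp_all
    fix \<phi> :: "real ^ 'n \<Rightarrow> 'n list \<Rightarrow> real" assume \<phi>: "\<phi> \<in> vector_test_functions d"
    then have t: "(\<lambda>x. \<phi> x w) \<in> test_functions" if "w \<in> ?I" for w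
      using that by (auto simp: vector_test_functions_def)
    have st: "integrable \<Lambda> (\<lambda>x. \<phi> x w * s w x)" "L w (\<lambda>x. \<phi> x w) = integral\<^sup>L \<Lambda> (\<lambda>x. \<phi> x w * s w x)"
      if "w \<in> ?I" for w
      using bspec[OF s that] t[OF that] L[OF that t[OF that]] by simp_all
    have "(\<Sum>w\<in>?I. L w (\<lambda>x. \<phi> x w)) = (\<Sum>w\<in>?I. integral\<^sup>L \<Lambda> (\<lambda>x. \<phi> x w * s w x))"
      by (intro sum.cong refl st)
    also have "\<dots> = (LINT x|\<Lambda>. (\<Sum>w\<in>?I. \<phi> x w * s w x))"
      by (intro Bochner_Integration.integral_sum[symmetric] st)
    finally show "(LINT x:cube|lebesgue. u x * formal_adjoint d B \<phi> x) =
      (LINT x|\<Lambda>. (\<Sum>w\<in>?I. \<phi> x w * s w x))" by (simp add: sum_L[OF \<phi>])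
  qed
qed

text \<open>A finite Borel measure on a Euclidean space is inner regular, and this passes to the
  cube because the compact sets inside a Borel subset of the cube are themselves subsets of the
  cube.\<close>

lemma radon_measure_restrict_cube:
  fixes M :: "(real ^ 'n::finite) measure"
  assumes s: "sets M = sets borel" and fin: "emeasure M (space M) \<noteq> \<infinity>"
  shows "radon_measure_on_cube (restrict_space M cube)"
proof -
  have cube: "cube \<inter> space M \<in> sets M"
    using s sets_eq_imp_space_eq[OF s] borel_open[OF open_cube] by simp
  have em: "emeasure (restrict_space M cube) A = emeasure M A" if "A \<subseteq> cube" for A
    by (rule emeasure_restrict_space[OF cube that])
  show ?thesis unfolding radon_measure_on_cube_def
  proof (intro conjI allI impI ballI)
    show "sets (restrict_space M cube) = sets (restrict_space borel cube)"
      by (rule sets_restrict_space_cong[OF s])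
    fix C :: "(real ^ 'n) set" assume "compact C \<and> C \<subseteq> cube"
    then have "emeasure (restrict_space M cube) C \<le> emeasure M (space M)"
      by (simp add: em emeasure_space)
    then show "emeasure (restrict_space M cube) C < \<infinity>"
      using fin by (simp add: less_top top_unique order_le_less_trans)
  next
    fix E :: "(real ^ 'n) set" assume "E \<in> sets (restrict_space M cube)"
    then have E: "E \<subseteq> cube" "E \<in> sets borel"
      using cube s sets_eq_imp_space_eq[OF s] by (auto simp: sets_restrict_space_iff)
    have "emeasure (restrict_space M cube) E = (SUP C\<in>{C. C \<subseteq> E \<and> compact C}. emeasure M C)"
      unfolding em[OF E(1)] by (rule inner_regular[OF s fin E(2)])
    also have "\<dots> = (SUP C\<in>{C. compact C \<and> C \<subseteq> E}. emeasure (restrict_space M cube) C)"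
      using E(1) by (intro SUP_cong) (auto simp: em)
    finally show "emeasure (restrict_space M cube) E =
      (SUP C\<in>{C. compact C \<and> C \<subseteq> E}. emeasure (restrict_space M cube) C)" .
  qed
qed

lemma BV_polar_decomposition:
  fixes u :: "real ^ 'n::finite \<Rightarrow> real"
  assumes u: "u \<in> BV d B"
  shows "\<exists>\<mu> (\<sigma> :: real ^ 'n \<Rightarrow> 'n list \<Rightarrow> real).
    radon_measure_on_cube \<mu> \<and>
    (\<forall>w\<in>multi_indices d. (\<lambda>x. \<sigma> x w) \<in> borel_measurable (completion \<mu>)) \<and>
    (AE x in \<mu>. L2_set (\<sigma> x) (multi_indices d) = 1) \<and>
    (\<forall>\<phi>\<in>vector_test_functions d.
       (LINT x:cube|lebesgue. u x * formal_adjoint d B \<phi> x) =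
       - (LINT x|completion \<mu>. (\<Sum>w\<in>multi_indices d. \<phi> x w * \<sigma> x w)))"
proof -
  let ?I = "multi_indices d :: 'n list set"
  obtain \<Lambda> s where \<Lambda>: "finite_measure \<Lambda>" "sets \<Lambda> = sets borel"
    and s: "\<And>w. w \<in> ?I \<Longrightarrow> s w \<in> borel_measurable borel" "\<And>w. w \<in> ?I \<Longrightarrow> integrable \<Lambda> (s w)"
    and rep: "\<And>\<phi>. \<phi> \<in> vector_test_functions d \<Longrightarrow>
      (LINT x:cube|lebesgue. u x * formal_adjoint d B \<phi> x) = (LINT x|\<Lambda>. (\<Sum>w\<in>?I. \<phi> x w * s w x))"
    using BV_structure[OF u] by blast
  have sp: "space \<Lambda> = UNIV" using sets_eq_imp_space_eq[OF \<Lambda>(2)] by simp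
  have m\<Lambda>: "f \<in> borel_measurable \<Lambda>" if "f \<in> borel_measurable borel" for f :: "real ^ 'n \<Rightarrow> real"
    using that measurable_cong_sets[OF \<Lambda>(2) refl] by blast
  define N where "N x = L2_set (\<lambda>w. s w x) ?I" for x
  \<comment> \<open>Where \<open>N x = 0\<close> the quotient is 0 by convention; the density
    \<open>N\<close> makes that set null for the new measure.\<close>
  define \<sigma> where "\<sigma> x w = - s w x / N x" for x w
  have Nm: "N \<in> borel_measurable borel"
  proof -
    have [measurable]: "(\<lambda>x. \<Sum>w\<in>?I. (s w x)\<^sup>2) \<in> borel_measurable borel"
      using s(1) by (intro borel_measurable_sum borel_measurable_power) blast
    show ?thesis unfolding N_def[abs_def] L2_set_def by measurable
  qed
  have N0: "N x \<ge> 0" for x by (simp add: N_def)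
  \<comment> \<open>Integrability of \<open>N\<close> makes \<open>M\<close> finite, which the Radon
    property rests on.\<close>
  have Ni: "integrable \<Lambda> N"
  proof (rule Bochner_Integration.integrable_bound[of _ "\<lambda>x. \<Sum>w\<in>?I. \<bar>s w x\<bar>"])
    show "integrable \<Lambda> (\<lambda>x. \<Sum>w\<in>?I. \<bar>s w x\<bar>)" using s(2) by simp
    show "AE x in \<Lambda>. norm (N x) \<le> norm (\<Sum>w\<in>?I. \<bar>s w x\<bar>)"
      using L2_set_le_sum_abs N0 by (intro AE_I2) (simp add: N_def sum_nonneg)
  qed (rule m\<Lambda>[OF Nm])
  define M where "M = density \<Lambda> (\<lambda>x. ennreal (N x))"
  have M: "sets M = sets borel" by (simp add: M_def \<Lambda>)
  have spM: "space M = UNIV" using sets_eq_imp_space_eq[OF M] by simp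
  have cube: "cube \<inter> space M \<in> sets M" using M spM borel_open[OF open_cube] by simp
  have finM: "emeasure M (space M) \<noteq> \<infinity>"
  proof -
    have "emeasure M (space M) = (\<integral>\<^sup>+x. ennreal (N x) \<partial>\<Lambda>)"
      unfolding spM using m\<Lambda>[OF Nm] sp unfolding M_def
      by (subst emeasure_density) (auto simp: \<Lambda>)
    also have "\<dots> = ennreal (integral\<^sup>L \<Lambda> N)"
      by (rule nn_integral_eq_integral[OF Ni]) (simp add: N0)
    finally show ?thesis by simp
  qed
  define \<mu> where "\<mu> = restrict_space M cube"
  have \<sigma>m: "(\<lambda>x. \<sigma> x w) \<in> borel_measurable borel" if "w \<in> ?I" for w
    unfolding \<sigma>_def using s(1)[OF that] Nm by (intro borel_measurable_divide borel_measurable_uminus)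
  have \<mu>m: "f \<in> borel_measurable \<mu>" if "f \<in> borel_measurable borel" for f :: "real ^ 'n \<Rightarrow> real"
    unfolding \<mu>_def using that measurable_cong_sets[OF M refl] by (intro measurable_restrict_space1) blast
  have unit: "L2_set (\<sigma> x) ?I = 1" if "N x \<noteq> 0" for x
  proof -
    have "L2_set (\<sigma> x) ?I = L2_set (\<lambda>w. (1 / N x) * s w x) ?I"
      by (simp add: L2_set_def \<sigma>_def power_divide)
    also have "\<dots> = (1 / N x) * N x"
      using N0[of x] unfolding N_def by (subst L2_set_right_distrib) simp_all
    finally show ?thesis using that by simp
  qed
  \<comment> \<open>This holds at every point: if the norm \<open>N x\<close> is 0, then all the
    components vanish as well.\<close>
  have s_eq: "N x * \<sigma> x w = - s w x" if "w \<in> ?I" for x w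
  proof (cases "N x = 0")
    case True
    then have "\<forall>w\<in>?I. s w x = 0"
      unfolding N_def by (subst (asm) L2_set_eq_0_iff) (auto simp: finite_multi_indices)
    with that True show ?thesis by simp
  qed (simp add: \<sigma>_def)
  show ?thesis
  proof (intro exI[of _ \<mu>] exI[of _ \<sigma>] conjI ballI)
    show "radon_measure_on_cube \<mu>"
      unfolding \<mu>_def by (rule radon_measure_restrict_cube[OF M finM])
    show "(\<lambda>x. \<sigma> x w) \<in> borel_measurable (completion \<mu>)" if "w \<in> ?I" for w
      by (intro measurable_completion \<mu>m \<sigma>m that)
    have "AE x in M. N x \<noteq> 0"
      unfolding M_def using m\<Lambda>[OF Nm] by (subst AE_density) auto
    then show "AE x in \<mu>. L2_set (\<sigma> x) ?I = 1"
      unfolding \<mu>_def AE_restrict_space_iff[OF cube] by eventually_elim (simp add: unit)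
    fix \<phi> :: "real ^ 'n \<Rightarrow> 'n list \<Rightarrow> real" assume \<phi>: "\<phi> \<in> vector_test_functions d"
    then have t: "(\<lambda>x. \<phi> x w) \<in> test_functions" if "w \<in> ?I" for w
      using that by (auto simp: vector_test_functions_def)
    have gm: "(\<lambda>x. \<Sum>w\<in>?I. \<phi> x w * \<sigma> x w) \<in> borel_measurable borel"
      using t by (intro borel_measurable_sum borel_measurable_times \<sigma>m borel_measurable_continuous_onI
          test_functions_continuous)
    have gm': "(\<lambda>x. indicator cube x * (\<Sum>w\<in>?I. \<phi> x w * \<sigma> x w)) \<in> borel_measurable borel"
      by (intro borel_measurable_times borel_measurable_indicator borel_open open_cube gm)
    have "(LINT x|completion \<mu>. (\<Sum>w\<in>?I. \<phi> x w * \<sigma> x w)) = (LINT x|\<mu>. (\<Sum>w\<in>?I. \<phi> x w * \<sigma> x w))"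
      by (rule integral_completion[OF \<mu>m[OF gm]])
    also have "\<dots> = (LINT x|M. indicator cube x * (\<Sum>w\<in>?I. \<phi> x w * \<sigma> x w))"
      unfolding \<mu>_def by (subst integral_restrict_space[OF cube]) simp
    also have "\<dots> = (LINT x|\<Lambda>. N x * (indicator cube x * (\<Sum>w\<in>?I. \<phi> x w * \<sigma> x w)))"
      unfolding M_def by (intro integral_real_density m\<Lambda> gm' Nm AE_I2 N0)
    also have "\<dots> = (LINT x|\<Lambda>. - (\<Sum>w\<in>?I. \<phi> x w * s w x))"
    proof (rule Bochner_Integration.integral_cong[OF refl])
      fix x
      have "N x * (\<Sum>w\<in>?I. \<phi> x w * \<sigma> x w) = (\<Sum>w\<in>?I. \<phi> x w * (N x * \<sigma> x w))"
        by (simp add: sum_distrib_left mult_ac)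
      also have "\<dots> = - (\<Sum>w\<in>?I. \<phi> x w * s w x)"
        by (simp add: s_eq sum_negf)
      finally have "N x * (\<Sum>w\<in>?I. \<phi> x w * \<sigma> x w) = - (\<Sum>w\<in>?I. \<phi> x w * s w x)" .
      \<comment> \<open>\<Lambda> may have mass outside the cube, which the restriction drops; no
        integral changes, since every component of \<phi> is zero there.\<close>
      moreover have "(\<Sum>w\<in>?I. \<phi> x w * s w x) = 0" if "x \<notin> cube"
        using test_functions_zero_outside[OF t that] by (intro sum.neutral) auto
      ultimately show "N x * (indicator cube x * (\<Sum>w\<in>?I. \<phi> x w * \<sigma> x w)) = - (\<Sum>w\<in>?I. \<phi> x w * s w x)"
        by (cases "x \<in> cube") auto
    qed
    finally show "(LINT x:cube|lebesgue. u x * formal_adjoint d B \<phi> x) =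
       - (LINT x|completion \<mu>. (\<Sum>w\<in>?I. \<phi> x w * \<sigma> x w))"
      by (simp add: rep[OF \<phi>])
  qed
qed

theorem proposition2p4:
  fixes d :: nat and B :: "nat \<Rightarrow> 'n::finite list \<Rightarrow> 'n list \<Rightarrow> real"
  assumes "d \<ge> 1"
  shows "(\<forall>u v. (\<forall>n. u n \<in> L1_cube) \<and> v \<in> L1_cube \<and>
            ((locally_uniformly_integrable u \<and>
                (AE x in lebesgue. x \<in> cube \<longrightarrow> (\<lambda>n. u n x) \<longlonglongrightarrow> v x)) \<or>
             weak_star_converges u v) \<longrightarrow>
            liminf (\<lambda>n. PV d B (u n)) \<ge> PV d B v) \<and>
         (\<forall>u\<in>BV d B. \<exists>\<mu> (\<sigma> :: real ^ 'n \<Rightarrow> 'n list \<Rightarrow> real).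
            radon_measure_on_cube \<mu> \<and>
            (\<forall>w\<in>multi_indices d. (\<lambda>x. \<sigma> x w) \<in> borel_measurable (completion \<mu>)) \<and>
            (AE x in \<mu>. L2_set (\<sigma> x) (multi_indices d) = 1) \<and>
            (\<forall>\<phi>\<in>vector_test_functions d.
               (LINT x:cube|lebesgue. u x * formal_adjoint d B \<phi> x) =
               - (LINT x|completion \<mu>. (\<Sum>w\<in>multi_indices d. \<phi> x w * \<sigma> x w))))"
proof (intro conjI allI impI ballI)
  fix u :: "nat \<Rightarrow> real ^ 'n \<Rightarrow> real" and v :: "real ^ 'n \<Rightarrow> real"
  assume *: "(\<forall>n. u n \<in> L1_cube) \<and> v \<in> L1_cube \<and>
    ((locally_uniformly_integrable u \<and> (AE x in lebesgue. x \<in> cube \<longrightarrow> (\<lambda>n. u n x) \<longlonglongrightarrow> v x)) \<or>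
     weak_star_converges u v)"
  show "PV d B v \<le> liminf (\<lambda>n. PV d B (u n))"
  proof (rule PV_lower_semicontinuous)
    fix g :: "real ^ 'n \<Rightarrow> real" assume g: "g \<in> test_functions"
    from * consider "locally_uniformly_integrable u" "AE x in lebesgue. x \<in> cube \<longrightarrow> (\<lambda>n. u n x) \<longlonglongrightarrow> v x"
      | "weak_star_converges u v" by blast
    then show "(\<lambda>n. LINT x:cube|lebesgue. u n x * g x) \<longlonglongrightarrow> (LINT x:cube|lebesgue. v x * g x)"
    proof cases
      case 1
      with * g show ?thesis by (intro locally_uniformly_integrable_imp_converges) auto
    next
      case 2
      then have "(\<lambda>n. LINT x:cube|lebesgue. g x * u n x) \<longlonglongrightarrow> (LINT x:cube|lebesgue. g x * v x)"
        using test_functions_C0[OF g] by (simp add: weak_star_converges_def)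
      then show ?thesis by (simp only: mult.commute)
    qed
  qed
qed (rule BV_polar_decomposition)

end
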